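(* Let $A=[\mathbf{a}_1,\ldots,\mathbf{a}_n]\in\mathbb{Z}_{\ge0}^{d\times n}$ and $B=[\mathbf{b}_1,\ldots,\mathbf{b}_m]\in\mathbb{Z}_{\ge0}^{d\times m}$, with $\mathbf{a}_n=\mathbf{b}_m=\mathbf{0}_d$, be of harmony, and suppose that $\mathrm{in}_{<_A}(I_A)\subset K[x_1,\ldots,x_n]$ and $\mathrm{in}_{<_B}(I_B)\subset K[y_1,\ldots,y_m]$ are squarefree with respect to reverse lexicographic orders $<_A$, $<_B$ such that $x_i<_A x_j$ whenever $i\ne j$ and $a_{ki}\le a_{kj}$ for all $1\le k\le d$, $x_n$ is the smallest variable for $<_A$, and $y_m$ is the smallest variable for $<_B$. Let $\mathcal{P}\subset\mathbb{R}^d$ be the lattice polytope with $\mathcal{P}\cap\mathbb{Z}^d=\{\mathbf{a}_1,\ldots,\mathbf{a}_n\}$ and $\mathcal{Q}\subset\mathbb{R}^d$ the lattice polytope with $\mathcal{Q}\cap\mathbb{Z}^d=\{\mathbf{b}_1,\ldots,\mathbf{b}_m\}$. Suppose that every integer point of $\mathbb{Z}^{d+1}$ is an integer linear combination of the integer points of $\Gamma(\mathcal{P},\mathcal{Q})\times\{1\}$, every integer point of $\mathbb{Z}^{d+2}$ is an integer linear combination of the integer points of $\Omega(\mathcal{P},\mathcal{Q})\times\{1\}$, \[\Gamma(\mathcal{P},\mathcal{Q})\cap\mathbb{Z}^d=\{\mathbf{a}_1,\ldots,\mathbf{a}_{n-1},-\mathbf{b}_1,\ldots,-\mathbf{b}_{m-1},\mathbf{0}_d\},\]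 and \[\Omega(\mathcal{P},\mathcal{Q})\cap\mathbb{Z}^{d+1}=\left\{\begin{bmatrix}\mathbf{a}_1\\1\end{bmatrix},\ldots,\begin{bmatrix}\mathbf{a}_n\\1\end{bmatrix},\begin{bmatrix}-\mathbf{b}_1\\-1\end{bmatrix},\ldots,\begin{bmatrix}-\mathbf{b}_m\\-1\end{bmatrix},\mathbf{0}_{d+1}\right\}.\] Then $\delta(\Omega(\mathcal{P},\mathcal{Q}),\lambda)=(1+\lambda)\,\delta(\Gamma(\mathcal{P},\mathcal{Q}),\lambda)$. In particular $\mathrm{vol}(\Omega(\mathcal{P},\mathcal{Q}))=2\cdot\mathrm{vol}(\Gamma(\mathcal{P},\mathcal{Q}))$.
   Context: $K$ is a field. For an integer $d\times n$ matrix $A=[\mathbf{a}_1,\ldots,\mathbf{a}_n]$, the toric ideal $I_A$ is the kernel of $K[x_1,\ldots,x_n]\to K[t_1^{\pm1},\ldots,t_d^{\pm1},s]$, $x_j\mapsto\mathbf{t}^{\mathbf{a}_j}s$. The reverse lexicographic order induced by $x_n<\cdots<x_1$: $x^a<x^b$ iff $\sum a_i<\sum b_i$, or the degrees are equal and the rightmost nonzero entry of $b-a$ is negative. An initial ideal is squarefree if generated by squarefree monomials. For $\mathbf{c}\in\mathbb{Z}^d$, $\mathbf{c}^{(+)}$, $\mathbf{c}^{(-)}$ have entries $\max\{0,c_i\}$, $\max\{0,-c_i\}$. $A\in\mathbb{Z}_{\ge0}^{d\times n}$, $B\in\mathbb{Z}_{\ge0}^{d\times m}$, each having $\mathbf{0}_d$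 as a column, are of harmony if for every column $\mathbf{a}$ of $A$ and $\mathbf{b}$ of $B$, with $\mathbf{c}=\mathbf{a}-\mathbf{b}$, $\mathbf{c}^{(+)}$ is a column of $A$ and $\mathbf{c}^{(-)}$ a column of $B$. $\Gamma(\mathcal{P},\mathcal{Q})=\mathrm{conv}(\mathcal{P}\cup(-\mathcal{Q}))\subset\mathbb{R}^d$ and $\Omega(\mathcal{P},\mathcal{Q})=\mathrm{conv}((\mathcal{P}\times\{1\})\cup(-\mathcal{Q}\times\{-1\}))\subset\mathbb{R}^{d+1}$. For a full-dimensional lattice polytope $\mathcal{R}\subset\mathbb{R}^N$, $\delta(\mathcal{R},\lambda)=(1-\lambda)^{N+1}[1+\sum_{n\ge1}|n\mathcal{R}\cap\mathbb{Z}^N|\lambda^n]$ and $\mathrm{vol}(\mathcal{R})=\delta(\mathcal{R},1)$ (normalized volume). *)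

theory Defs
  imports "HOL-Analysis.Analysis" "HOL-Library.Poly_Mapping"
begin

text \<open>
  An integer \<open>d \<times> n\<close> matrix is a term of type \<open>int ^ 'n ^ 'd\<close>, its columns being indexed by the
  finite type \<open>'n\<close>. The monomial with exponent vector \<open>u\<close> is \<open>Poly_Mapping.single u 1\<close>.
\<close>

type_synonym ('v, 'k) mpolynomial = "('v \<Rightarrow>\<^sub>0 nat) \<Rightarrow>\<^sub>0 'k"

text \<open>
  The ring of Laurent polynomials in the variables \<open>t\<close> and ordinary polynomials in \<open>s\<close>: the
  exponent \<open>(c, e)\<close> stands for \<open>t\<^sup>c s\<^sup>e\<close>.
\<close>

type_synonym ('d, 'k) laurent_s = "((int ^ 'd) \<times> nat) \<Rightarrow>\<^sub>0 'k"

definition toric_map ::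
  "int ^ 'n ^ 'd \<Rightarrow> ('n::finite, 'k::field) mpolynomial \<Rightarrow> ('d::finite, 'k) laurent_s"
  where "toric_map A f =
    (\<Sum>u\<in>Poly_Mapping.keys f. Poly_Mapping.single 0 (Poly_Mapping.lookup f u) *
       (\<Prod>j\<in>UNIV. Poly_Mapping.single (column j A, 1) 1 ^ Poly_Mapping.lookup u j))"

definition toric_ideal :: "int ^ 'n ^ 'd::finite \<Rightarrow> ('n::finite, 'k::field) mpolynomial set"
  where "toric_ideal A = {f. toric_map A f = 0}"

definition monomial_degree :: "('v \<Rightarrow>\<^sub>0 nat) \<Rightarrow> nat"
  where "monomial_degree u = (\<Sum>j\<in>Poly_Mapping.keys u. Poly_Mapping.lookup u j)"

text \<open>
  The reverse lexicographic order induced by a strict linear order \<open>r\<close> of the variables, where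
  \<open>(i, j) \<in> r\<close> means that the \<open>i\<close>-th variable is smaller than the \<open>j\<close>-th one. When exponents are
  listed with the variables decreasing from left to right, \<open>k\<close> below is the rightmost position
  where \<open>u\<close> and \<open>v\<close> differ.
\<close>

definition revlex_less :: "'v rel \<Rightarrow> ('v \<Rightarrow>\<^sub>0 nat) \<Rightarrow> ('v \<Rightarrow>\<^sub>0 nat) \<Rightarrow> bool"
  where "revlex_less r u v \<longleftrightarrow>
    monomial_degree u < monomial_degree v \<or>
    monomial_degree u = monomial_degree v \<and>
    (\<exists>k. Poly_Mapping.lookup v k < Poly_Mapping.lookup u k \<and>
         (\<forall>j. (j, k) \<in> r \<longrightarrow> Poly_Mapping.lookup u j = Poly_Mapping.lookup v j))"

definition is_initial_exponent :: "'v rel \<Rightarrow> ('v, 'k::zero) mpolynomial \<Rightarrow> ('v \<Rightarrow>\<^sub>0 nat) \<Rightarrow> bool"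
  where "is_initial_exponent r f u \<longleftrightarrow>
    u \<in> Poly_Mapping.keys f \<and> (\<forall>v\<in>Poly_Mapping.keys f. v \<noteq> u \<longrightarrow> revlex_less r v u)"

definition ideal_generated :: "'a::comm_ring_1 set \<Rightarrow> 'a set"
  where "ideal_generated S = module.span (*) S"

text \<open>No zero test is needed below: only nonzero polynomials have an initial exponent.\<close>

definition initial_ideal ::
  "'v rel \<Rightarrow> ('v, 'k::field) mpolynomial set \<Rightarrow> ('v, 'k) mpolynomial set"
  where "initial_ideal r I =
    ideal_generated {Poly_Mapping.single u 1 | u. \<exists>f\<in>I. is_initial_exponent r f u}"

definition squarefree_ideal :: "('v, 'k::field) mpolynomial set \<Rightarrow> bool"
  where "squarefree_ideal J \<longleftrightarrow>
    (\<exists>E. (\<forall>u\<in>E. \<forall>j. Poly_Mapping.lookup u j \<le> 1) \<and>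
         J = ideal_generated ((\<lambda>u. Poly_Mapping.single u 1) ` E))"

definition pos_part_vec :: "int ^ 'd \<Rightarrow> int ^ 'd"
  where "pos_part_vec c = (\<chi> k. max 0 (c $ k))"

definition neg_part_vec :: "int ^ 'd \<Rightarrow> int ^ 'd"
  where "neg_part_vec c = (\<chi> k. max 0 (- (c $ k)))"

definition nonneg_matrix :: "int ^ 'n ^ 'd \<Rightarrow> bool"
  where "nonneg_matrix A \<longleftrightarrow> (\<forall>k j. 0 \<le> A $ k $ j)"

definition of_harmony :: "int ^ 'n ^ 'd \<Rightarrow> int ^ 'm ^ 'd \<Rightarrow> bool"
  where "of_harmony A B \<longleftrightarrow>
    nonneg_matrix A \<and> nonneg_matrix B \<and> 0 \<in> columns A \<and> 0 \<in> columns B \<and>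
    (\<forall>a\<in>columns A. \<forall>b\<in>columns B.
       pos_part_vec (a - b) \<in> columns A \<and> neg_part_vec (a - b) \<in> columns B)"

definition real_vec :: "int ^ 'd \<Rightarrow> real ^ 'd"
  where "real_vec v = (\<chi> k. real_of_int (v $ k))"

text \<open>
  \<open>\<real>\<^sup>d\<^sup>+\<^sup>1\<close> and \<open>\<real>\<^sup>d\<^sup>+\<^sup>2\<close> appear as \<open>(real ^ 'd) \<times> real\<close> and \<open>((real ^ 'd) \<times> real) \<times> real\<close>; on all of
  these types \<open>Basis\<close> is the standard basis.
\<close>

definition integer_points :: "'a::euclidean_space set"
  where "integer_points = {x. \<forall>b\<in>Basis. x \<bullet> b \<in> \<int>}"

definition integer_combinations :: "'a::real_vector set \<Rightarrow> 'a set"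
  where "integer_combinations S =
    {(\<Sum>x\<in>F. real_of_int (c x) *\<^sub>R x) | F c. finite F \<and> F \<subseteq> S}"

definition lattice_polytope :: "'a::euclidean_space set \<Rightarrow> bool"
  where "lattice_polytope P \<longleftrightarrow> (\<exists>V. finite V \<and> V \<subseteq> integer_points \<and> P = convex hull V)"

definition Gamma_polytope :: "(real ^ 'd) set \<Rightarrow> (real ^ 'd) set \<Rightarrow> (real ^ 'd) set"
  where "Gamma_polytope P Q = convex hull (P \<union> uminus ` Q)"

definition Omega_polytope :: "(real ^ 'd) set \<Rightarrow> (real ^ 'd) set \<Rightarrow> ((real ^ 'd) \<times> real) set"
  where "Omega_polytope P Q = convex hull (P \<times> {1} \<union> (uminus ` Q) \<times> {-1})"

text \<open>
  The \<open>\<delta>\<close>-polynomial as a formal power series in \<open>\<lambda>\<close>; by Ehrhart's theorem only finitely many of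
  its coefficients are nonzero when \<open>R\<close> is a full-dimensional lattice polytope, so \<open>eval_fps\<close>
  evaluates a polynomial.
\<close>

definition delta :: "'a::euclidean_space set \<Rightarrow> real fps"
  where "delta R = (1 - fps_X) ^ (DIM('a) + 1) *
    Abs_fps (\<lambda>n. if n = 0 then 1
                 else real (card (((\<lambda>x. real n *\<^sub>R x) ` R) \<inter> integer_points)))"

definition normalized_volume :: "'a::euclidean_space set \<Rightarrow> real"
  where "normalized_volume R = eval_fps (delta R) 1"

end

theory Submission
  imports Defs
begin

text \<open>
  Call a monomial standard if it is the least one in its fibre under \<open>toric_map A\<close>. Squarefreeness of
  the initial ideal says that being standard depends only on the support, and this makes the
  configuration normal: every lattice point of the cone over the columns of \<open>A\<close> is the weight of a
  unique standard monomial that avoids the variable \<open>x\<^sub>p\<close> of the zero column, and the degree of that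
  monomial is at most the coefficient sum of any real representation of the point.

  By harmony, a representation \<open>A\<alpha> - B\<beta>\<close> of an integer point \<open>z\<close> can be changed, without changing
  the coefficient sums, so that \<open>A\<alpha>\<close> and \<open>B\<beta>\<close> are the positive and the negative part of \<open>z\<close>. Hence
  the integer points of \<open>n\<Gamma>\<close> correspond to the pairs \<open>t = (u, v)\<close> of such monomials whose weights have
  disjoint supports and with \<open>|u| + |v| \<le> n\<close>, while over each of these \<open>n\<Omega>\<close> has the points of height
  \<open>2|u| - n \<le> h \<le> n - 2|v|\<close>. The numbers of points therefore satisfy \<open>\<omega>(n+1) = \<omega>(n) + \<gamma>(n) + \<gamma>(n+1)\<close>,
  which is the identity of the \<open>\<delta>\<close>-series. As the admissible pairs are determined by their supports,
  which have at most \<open>d\<close> elements, the \<open>\<delta>\<close>-series are polynomials and can be evaluated at \<open>1\<close>.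
\<close>

section \<open>Standard monomials of a toric ideal\<close>

text \<open>As the variables form a finite type, exponents are plain functions here.
  \<open>weight A u\<close> and \<open>total_degree u\<close> are the exponents of \<open>t\<close>
  and \<open>s\<close> in the image of the monomial \<open>u\<close>, see
  \<open>toric_map_monomial\<close>.\<close>

definition weight :: "int ^ 'n ^ 'd \<Rightarrow> ('n::finite \<Rightarrow> nat) \<Rightarrow> int ^ 'd::finite"
  where "weight A u = (\<chi> k. \<Sum>j\<in>UNIV. A $ k $ j * int (u j))"

definition total_degree :: "('n::finite \<Rightarrow> nat) \<Rightarrow> nat"
  where "total_degree u = (\<Sum>j\<in>UNIV. u j)"

definition support :: "('n \<Rightarrow> nat) \<Rightarrow> 'n set"
  where "support u = {j. u j \<noteq> 0}"

definition same_image :: "int ^ 'n ^ 'd \<Rightarrow> ('n::finite \<Rightarrow> nat) \<Rightarrow> ('n \<Rightarrow> nat) \<Rightarrow> bool"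
  where "same_image A u v \<longleftrightarrow> weight A u = weight A (v :: 'n \<Rightarrow> nat) \<and> total_degree u = total_degree v"

text \<open>Only the tie-breaking clause of \<open>revlex_less\<close>: the monomials compared in
  \<open>standard\<close> lie in one fibre, hence have equal degree.\<close>

definition revlex :: "'n rel \<Rightarrow> ('n \<Rightarrow> nat) \<Rightarrow> ('n \<Rightarrow> nat) \<Rightarrow> bool"
  where "revlex r u v \<longleftrightarrow> (\<exists>k. v k < u k \<and> (\<forall>j. (j, k) \<in> r \<longrightarrow> u j = v j))"

definition standard :: "'n rel \<Rightarrow> int ^ 'n ^ 'd \<Rightarrow> ('n::finite \<Rightarrow> nat) \<Rightarrow> bool"
  where "standard r A u \<longleftrightarrow> (\<forall>v. same_image A v u \<longrightarrow> \<not> revlex r v u)"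

lemma weight_add [simp]: "weight A (\<lambda>j. u j + v j) = weight A u + weight A v"
  by (simp add: weight_def vec_eq_iff algebra_simps sum.distrib)

lemma weight_mult [simp]: "weight A (\<lambda>j. N * u j) = int N *s weight A u"
  by (simp add: weight_def vec_eq_iff algebra_simps sum_distrib_left)

lemma total_degree_add [simp]: "total_degree (\<lambda>j. u j + v j) = total_degree u + total_degree v"
  by (simp add: total_degree_def sum.distrib)

lemma total_degree_mult [simp]: "total_degree (\<lambda>j. N * u j) = N * total_degree u"
  by (simp add: total_degree_def sum_distrib_left)

lemma same_image_refl [simp]: "same_image A u u"
  by (simp add: same_image_def)

lemma same_image_trans: "same_image A u v \<Longrightarrow> same_image A v w \<Longrightarrow> same_image A u w"
  by (simp add: same_image_def)

lemma same_image_sym: "same_image A u v \<Longrightarrow> same_image A v u"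
  by (simp add: same_image_def)

lemma finite_total_degree_le: "finite {u :: 'n::finite \<Rightarrow> nat. total_degree u \<le> D}"
proof (rule finite_subset)
  show "{u :: 'n \<Rightarrow> nat. total_degree u \<le> D} \<subseteq> (\<Pi>\<^sub>E j\<in>UNIV. {..D})"
  proof
    fix u :: "'n \<Rightarrow> nat" assume u: "u \<in> {u. total_degree u \<le> D}"
    have "u j \<le> total_degree u" for j
      unfolding total_degree_def by (rule member_le_sum) auto
    with u show "u \<in> (\<Pi>\<^sub>E j\<in>UNIV. {..D})"
      by (auto intro: order_trans)
  qed
qed (auto intro: finite_PiE)

lemma linear_order_least:
  fixes r :: "'n::finite rel"
  assumes "strict_linear_order_on UNIV r" "S \<noteq> {}"
  shows "\<exists>k\<in>S. \<forall>j. (j, k) \<in> r \<longrightarrow> j \<notin> S"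
proof -
  have "\<exists>m\<in>S. \<forall>x\<in>S. x \<noteq> m \<longrightarrow> (x, m) \<notin> r"
    using assms
    by (intro Finite_Set.bex_min_element)
      (auto simp: strict_linear_order_on_def asymp_on_def transp_on_def trans_def irrefl_def)
  then obtain m where m: "m \<in> S" "\<And>x. x \<in> S \<Longrightarrow> x \<noteq> m \<Longrightarrow> (x, m) \<notin> r" by blast
  moreover have "(m, m) \<notin> r"
    using assms(1) by (simp add: strict_linear_order_on_def irrefl_def)
  ultimately show ?thesis by (intro bexI[of _ m]) auto
qed

lemma revlex_total:
  fixes r :: "'n::finite rel"
  assumes "strict_linear_order_on UNIV r" "u \<noteq> v"
  shows "revlex r u v \<or> revlex r v u"
proof -
  from assms(2) have "{j. u j \<noteq> v j} \<noteq> {}" by auto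
  from linear_order_least[OF assms(1) this] obtain k
    where "u k \<noteq> v k" and k: "\<forall>j. (j, k) \<in> r \<longrightarrow> u j = v j" by auto
  with k have "(v k < u k \<and> (\<forall>j. (j, k) \<in> r \<longrightarrow> u j = v j)) \<or> (u k < v k \<and> (\<forall>j. (j, k) \<in> r \<longrightarrow> v j = u j))"
    by auto
  then show ?thesis unfolding revlex_def by blast
qed

lemma revlex_irrefl: "\<not> revlex r u u"
  by (auto simp: revlex_def)

lemma revlex_trans:
  assumes r: "strict_linear_order_on UNIV r" and "revlex r u v" "revlex r v w"
  shows "revlex r u w"
proof -
  from assms(2) obtain k where k: "v k < u k" "\<And>j. (j, k) \<in> r \<Longrightarrow> u j = v j"
    by (auto simp: revlex_def)
  from assms(3) obtain l where l: "w l < v l" "\<And>j. (j, l) \<in> r \<Longrightarrow> v j = w j"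
    by (auto simp: revlex_def)
  have tr: "trans r" and tot: "k = l \<or> (k, l) \<in> r \<or> (l, k) \<in> r"
    using r by (auto simp: strict_linear_order_on_def total_on_def)
  from tot show ?thesis
  proof (elim disjE)
    assume "k = l" then show ?thesis unfolding revlex_def
      using k l by (intro exI[of _ k]) auto
  next
    assume "(k, l) \<in> r" then show ?thesis unfolding revlex_def
      using k l tr by (metis transD)
  next
    assume "(l, k) \<in> r" then show ?thesis unfolding revlex_def
      using k l tr by (metis transD)
  qed
qed

lemma revlex_add: "revlex r u v \<Longrightarrow> revlex r (\<lambda>j. u j + w j) (\<lambda>j. v j + w j)"
  by (auto simp: revlex_def)

text \<open>A fibre fixes the total degree, so it is finite, and \<open>revlex\<close> has a minimal
  element on it.\<close>

lemma standard_exists: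
  assumes r: "strict_linear_order_on UNIV r"
  obtains v where "standard r A v" "same_image A v u"
proof -
  let ?S = "{v. same_image A v u}"
  have "finite ?S"
    by (rule finite_subset[OF _ finite_total_degree_le[of "total_degree u"]]) (auto simp: same_image_def)
  moreover have "?S \<noteq> {}" using same_image_refl by blast
  moreover have "asymp_on ?S (revlex r)" "transp_on ?S (revlex r)"
    using revlex_trans[OF r] revlex_irrefl by (fast intro: asymp_onI, fast intro: transp_onI)
  ultimately have "\<exists>m\<in>?S. \<forall>x\<in>?S. x \<noteq> m \<longrightarrow> \<not> revlex r x m"
    by (intro Finite_Set.bex_min_element)
  then obtain m where "same_image A m u"
    "\<And>x. same_image A x u \<Longrightarrow> x \<noteq> m \<Longrightarrow> \<not> revlex r x m" by auto
  then show thesis using that[of m]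
    unfolding standard_def by (metis revlex_irrefl same_image_trans)
qed

lemma standard_unique:
  assumes "strict_linear_order_on UNIV r" "standard r A u" "standard r A v" "same_image A u v"
  shows "u = v"
proof (rule ccontr)
  assume "u \<noteq> v"
  from revlex_total[OF assms(1) this] show False
    using assms(2-4) same_image_sym[OF assms(4)] by (auto simp: standard_def)
qed

text \<open>Since \<open>p\<close> is the smallest variable, a monomial that is
  \<open>revlex\<close>-below \<open>u\<close> times a power of the variable \<open>p\<close>
  contains that power as well. Cancelling it leaves a monomial below \<open>u\<close> in the fibre
  of \<open>u\<close>.\<close>

lemma standard_add_least:
  fixes A :: "int ^ 'n ^ 'd"
  assumes r: "strict_linear_order_on UNIV r" and p: "\<And>i. i \<noteq> p \<Longrightarrow> (p, i) \<in> r"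
    and u: "standard r A u"
  shows "standard r A (u(p := u p + k))"
  unfolding standard_def
proof (intro allI impI notI)
  fix v assume im: "same_image A v (u(p := u p + k))" and less: "revlex r v (u(p := u p + k))"
  let ?e = "\<lambda>j. if j = p then k else 0"
  have eq: "u(p := u p + k) = (\<lambda>j. u j + ?e j)" by auto
  from less obtain l where l: "(u(p := u p + k)) l < v l"
      "\<And>j. (j, l) \<in> r \<Longrightarrow> v j = (u(p := u p + k)) j"
    by (auto simp: revlex_def)
  \<comment> \<open>The exponents agree below the deciding position \<open>l\<close>; hence at
    \<open>p\<close>, unless \<open>p\<close> itself is \<open>l\<close>, where \<open>v\<close> has
    the larger exponent.\<close>
  have vp: "u p + k \<le> v p"
  proof (cases "l = p")
    case True then show ?thesis using l(1) by simp
  next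
    case False then show ?thesis using l(2)[OF p[OF False]] by simp
  qed
  let ?v = "v(p := v p - k)"
  have v: "v = (\<lambda>j. ?v j + ?e j)" using vp by auto
  have "same_image A ?v u"
    using im unfolding eq same_image_def
    by (subst (asm) (1 2) v) (simp only: weight_add total_degree_add add_right_cancel)
  moreover have "revlex r ?v u"
    using l vp unfolding revlex_def by (intro exI[of _ l]) (auto split: if_splits)
  ultimately show False using u by (auto simp: standard_def)
qed

lemma nonstandard_add:
  assumes "\<not> standard r A u"
  shows "\<not> standard r A (\<lambda>j. u j + w j)"
proof -
  from assms obtain v where "same_image A v u" "revlex r v u"
    by (auto simp: standard_def)
  then have "same_image A (\<lambda>j. v j + w j) (\<lambda>j. u j + w j)" "revlex r (\<lambda>j. v j + w j) (\<lambda>j. u j + w j)"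
    by (simp_all add: same_image_def revlex_add)
  then show ?thesis by (auto simp: standard_def)
qed

section \<open>Initial ideals\<close>

lemma module_times_ring: "module ((*) :: 'a::comm_ring_1 \<Rightarrow> 'a \<Rightarrow> 'a)"
  by unfold_locales (simp_all add: algebra_simps)

text \<open>The polynomials all of whose monomials are divisible by some generator form an ideal
  that contains the generators, so the span stays inside it.\<close>

lemma single_mem_ideal_generated:
  "Poly_Mapping.single u (1 :: 'k::field) \<in> ideal_generated ((\<lambda>u. Poly_Mapping.single u 1) ` E) \<longleftrightarrow>
   (\<exists>e\<in>E. \<exists>w. (u :: 'v \<Rightarrow>\<^sub>0 nat) = w + e)"
  (is "?L \<longleftrightarrow> ?R")
proof
  interpret M: module "(*) :: ('v, 'k) mpolynomial \<Rightarrow> _" by (rule module_times_ring)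
  let ?S = "{f :: ('v, 'k) mpolynomial. \<forall>u\<in>Poly_Mapping.keys f. \<exists>e\<in>E. \<exists>w. u = w + e}"
  {
    assume ?L
    moreover have "M.span ((\<lambda>u. Poly_Mapping.single u 1) ` E) \<subseteq> ?S"
    proof (rule M.span_minimal)
      show "(\<lambda>u. Poly_Mapping.single u 1) ` E \<subseteq> ?S"
      proof (clarsimp)
        fix e assume "e \<in> E"
        moreover have "e = 0 + e" by simp
        ultimately show "\<exists>e'\<in>E. \<exists>w. e = w + e'" by blast
      qed
      show "M.subspace ?S"
      proof (rule M.subspaceI)
        show "0 \<in> ?S" by simp
        show "x + y \<in> ?S" if "x \<in> ?S" "y \<in> ?S" for x y
          using that keys_add[of x y] by blast
        show "c * x \<in> ?S" if "x \<in> ?S" for c x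
        proof clarify
          fix u assume "u \<in> Poly_Mapping.keys (c * x)"
          from subsetD[OF keys_mult this] obtain a b where ab: "u = a + b" "b \<in> Poly_Mapping.keys x"
            by auto
          with that obtain e w where e: "e \<in> E" "b = w + e" by auto
          with ab have "u = (a + w) + e" by (simp add: add.assoc)
          with e(1) show "\<exists>e\<in>E. \<exists>w. u = w + e" by auto
        qed
      qed
    qed
    ultimately show ?R unfolding ideal_generated_def by auto
  }
  {
    assume ?R
    then obtain e w where "e \<in> E" "u = w + e" by blast
    then have "Poly_Mapping.single u (1::'k) = Poly_Mapping.single w 1 * Poly_Mapping.single e 1"
      by (simp add: mult_single)
    then show ?L unfolding ideal_generated_def
      using \<open>e \<in> E\<close> by (metis M.span_base M.span_scale imageI)
  }
qed

lemma toric_map_monomial: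
  fixes A :: "int ^ 'n ^ 'd::finite" and u :: "'n::finite \<Rightarrow>\<^sub>0 nat"
  shows "(\<Prod>j\<in>UNIV. Poly_Mapping.single (column j A, 1) (1::'k::field) ^ Poly_Mapping.lookup u j) =
    Poly_Mapping.single (weight A (Poly_Mapping.lookup u), total_degree (Poly_Mapping.lookup u)) 1"
proof -
  have pow: "Poly_Mapping.single (a :: (int ^ 'd) \<times> nat) (1::'k) ^ n =
      Poly_Mapping.single (int n *s fst a, n * snd a) 1" for a n
    by (induction n) (auto simp: mult_single single_one[symmetric] zero_prod_def algebra_simps prod_eq_iff plus_prod_def)
  have "(\<Prod>j\<in>S. Poly_Mapping.single (f j :: (int ^ 'd) \<times> nat) (1::'k)) = Poly_Mapping.single (sum f S) 1"
    if "finite S" for S :: "'n set" and f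
    using that by (induction S) (auto simp: mult_single)
  then show ?thesis
    by (auto simp: pow weight_def total_degree_def column_def prod_eq_iff fst_sum snd_sum vec_eq_iff
        intro!: arg_cong2[where f = Poly_Mapping.single] sum.cong)
qed

lemma lookup_toric_map:
  fixes A :: "int ^ 'n ^ 'd::finite" and f :: "('n::finite, 'k::field) mpolynomial"
  shows "Poly_Mapping.lookup (toric_map A f) z =
    (\<Sum>u\<in>Poly_Mapping.keys f.
      if (weight A (Poly_Mapping.lookup u), total_degree (Poly_Mapping.lookup u)) = z
      then Poly_Mapping.lookup f u else 0)"
  unfolding toric_map_def toric_map_monomial mult_single
  by (simp add: lookup_sum lookup_single when_def)

lemma monomial_degree_eq: "monomial_degree u = total_degree (Poly_Mapping.lookup u)"
  unfolding monomial_degree_def total_degree_def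
  by (rule sum.mono_neutral_left) (auto simp: in_keys_iff)

lemma revlex_less_iff:
  assumes "total_degree (Poly_Mapping.lookup u) = total_degree (Poly_Mapping.lookup v)"
  shows "revlex_less r u v \<longleftrightarrow> revlex r (Poly_Mapping.lookup u) (Poly_Mapping.lookup v)"
  using assms by (auto simp: revlex_less_def revlex_def monomial_degree_eq)

text \<open>The leading monomial of a kernel element must cancel under \<open>toric_map\<close>, so
  another monomial of the element shares its image and is smaller. Conversely, a smaller monomial in
  the fibre gives a binomial in the kernel.\<close>

lemma initial_exponent_toric_ideal_iff:
  fixes A :: "int ^ 'n ^ 'd::finite"
  shows "(\<exists>f\<in>(toric_ideal A :: ('n::finite, 'k::field) mpolynomial set). is_initial_exponent r f u)
    \<longleftrightarrow> \<not> standard r A (Poly_Mapping.lookup u)" (is "?L \<longleftrightarrow> ?R")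
proof
  let ?im = "\<lambda>u. (weight A (Poly_Mapping.lookup u), total_degree (Poly_Mapping.lookup u))"
  {
    assume ?L
    then obtain f :: "('n, 'k) mpolynomial" where f: "toric_map A f = 0" "is_initial_exponent r f u"
      by (auto simp: toric_ideal_def)
    from f(2) have u: "u \<in> Poly_Mapping.keys f" by (simp add: is_initial_exponent_def)
    have "\<exists>v\<in>Poly_Mapping.keys f. v \<noteq> u \<and> ?im v = ?im u"
    proof (rule ccontr)
      assume "\<not> ?thesis"
      then have "(\<Sum>v\<in>Poly_Mapping.keys f. if ?im v = ?im u then Poly_Mapping.lookup f v else 0)
          = (\<Sum>v\<in>Poly_Mapping.keys f. if v = u then Poly_Mapping.lookup f v else 0)"
        by (intro sum.cong) auto
      also have "\<dots> = Poly_Mapping.lookup f u" using u by simp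
      finally have "Poly_Mapping.lookup f u = 0"
        using lookup_toric_map[of A f "?im u"] f(1) by simp
      with u show False by (simp add: in_keys_iff)
    qed
    then obtain v where "v \<in> Poly_Mapping.keys f" "v \<noteq> u" "?im v = ?im u" by blast
    then show ?R
      using f(2) revlex_less_iff[of v u r] unfolding is_initial_exponent_def standard_def same_image_def
      by auto
  }
  {
    assume ?R
    then obtain v' where v': "same_image A v' (Poly_Mapping.lookup u)" "revlex r v' (Poly_Mapping.lookup u)"
      by (auto simp: standard_def)
    define v where "v = Abs_poly_mapping v'"
    have lv: "Poly_Mapping.lookup v = v'" unfolding v_def by (rule lookup_Abs_poly_mapping) simp
    have im: "?im v = ?im u" using v'(1) lv by (simp add: same_image_def)
    have less: "revlex_less r v u" using v' lv revlex_less_iff[of v u r] by (simp add: same_image_def)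
    have neq: "v \<noteq> u" using v'(2) lv revlex_irrefl by metis
    define f where "f = Poly_Mapping.single u (1::'k) - Poly_Mapping.single v 1"
    have lf: "Poly_Mapping.lookup f w = (if w = u then 1 else if w = v then -1 else 0)" for w
      using neq by (auto simp: f_def lookup_minus lookup_single when_def)
    have keys: "Poly_Mapping.keys f = {u, v}" by (auto simp: in_keys_iff lf split: if_splits)
    have "toric_map A f = 0"
      by (rule poly_mapping_eqI) (use neq im in \<open>auto simp: lookup_toric_map keys lf\<close>)
    moreover have "is_initial_exponent r f u"
      using less by (simp add: is_initial_exponent_def keys)
    ultimately show ?L by (auto simp: toric_ideal_def)
  }
qed

text \<open>Multiples of nonstandard monomials are nonstandard, so the standard monomials are
  exactly those outside the initial ideal.\<close>

lemma single_mem_initial_ideal_iff: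
  fixes A :: "int ^ 'n ^ 'd::finite"
  shows "Poly_Mapping.single u 1 \<in>
      initial_ideal r (toric_ideal A :: ('n::finite, 'k::field) mpolynomial set)
    \<longleftrightarrow> \<not> standard r A (Poly_Mapping.lookup u)"
proof -
  have "Poly_Mapping.single u (1::'k) \<in> initial_ideal r (toric_ideal A) \<longleftrightarrow>
    (\<exists>e\<in>{e. \<not> standard r A (Poly_Mapping.lookup e)}. \<exists>w. u = w + e)"
    unfolding initial_ideal_def initial_exponent_toric_ideal_iff
    by (simp only: setcompr_eq_image single_mem_ideal_generated)
  also have "\<dots> \<longleftrightarrow> \<not> standard r A (Poly_Mapping.lookup u)"
  proof
    assume "\<exists>e\<in>{e. \<not> standard r A (Poly_Mapping.lookup e)}. \<exists>w. u = w + e"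
    then obtain e w where e: "\<not> standard r A (Poly_Mapping.lookup e)" and "u = e + w"
      by (auto simp: add.commute)
    then have "Poly_Mapping.lookup u = (\<lambda>j. Poly_Mapping.lookup e j + Poly_Mapping.lookup w j)"
      by (auto simp: lookup_add)
    with nonstandard_add[OF e] show "\<not> standard r A (Poly_Mapping.lookup u)" by simp
  next
    assume "\<not> standard r A (Poly_Mapping.lookup u)"
    moreover have "u = 0 + u" by simp
    ultimately show "\<exists>e\<in>{e. \<not> standard r A (Poly_Mapping.lookup e)}. \<exists>w. u = w + e" by blast
  qed
  finally show ?thesis .
qed

text \<open>A squarefree generator that divides \<open>v\<close> has exponents at most 1 and support
  inside that of \<open>u\<close>, so it divides \<open>u\<close> too.\<close>

lemma standard_support_mono:
  fixes A :: "int ^ 'n ^ 'd::finite"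
  assumes sq: "squarefree_ideal (initial_ideal r (toric_ideal A :: ('n::finite, 'k::field) mpolynomial set))"
    and u: "standard r A u" and sub: "support v \<subseteq> support u"
  shows "standard r A v"
proof (rule ccontr)
  assume nv: "\<not> standard r A v"
  from sq obtain E where E: "\<And>e j. e \<in> E \<Longrightarrow> Poly_Mapping.lookup e j \<le> 1"
    and J: "initial_ideal r (toric_ideal A :: ('n, 'k) mpolynomial set) =
      ideal_generated ((\<lambda>u. Poly_Mapping.single u 1) ` E)"
    unfolding squarefree_ideal_def by blast
  have iff: "\<not> standard r A w \<longleftrightarrow> (\<exists>e\<in>E. \<exists>w'. Abs_poly_mapping w = w' + e)" for w
    using single_mem_initial_ideal_iff[of "Abs_poly_mapping w" r A, where 'k = 'k]
    unfolding J single_mem_ideal_generated by simp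
  from nv iff obtain e w' where e: "e \<in> E" "Abs_poly_mapping v = w' + e" by blast
  have "Poly_Mapping.lookup e j \<le> u j" for j
  proof -
    have "v j = Poly_Mapping.lookup w' j + Poly_Mapping.lookup e j"
      using arg_cong[OF e(2), of "\<lambda>x. Poly_Mapping.lookup x j"] by (simp add: lookup_add)
    then have "Poly_Mapping.lookup e j \<noteq> 0 \<Longrightarrow> u j \<noteq> 0"
      using sub by (auto simp: support_def subset_iff)
    then show ?thesis using E[OF e(1), of j] by linarith
  qed
  then have "Abs_poly_mapping u = Abs_poly_mapping (\<lambda>j. u j - Poly_Mapping.lookup e j) + e"
    by (intro poly_mapping_eqI) (simp add: lookup_add)
  with e(1) iff[of u] u show False by blast
qed

section \<open>Normality\<close>

lemma nat_seq_mono_subseq: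
  fixes s :: "nat \<Rightarrow> nat"
  shows "\<exists>g :: nat \<Rightarrow> nat. strict_mono g \<and> (\<forall>m n. m \<le> n \<longrightarrow> s (g m) \<le> s (g n))"
proof -
  obtain g where g: "strict_mono g" "monoseq (\<lambda>n. s (g n))"
    using seq_monosub by blast
  then consider "\<forall>m. \<forall>n\<ge>m. s (g m) \<le> s (g n)" | "\<forall>m. \<forall>n\<ge>m. s (g n) \<le> s (g m)"
    by (auto simp: monoseq_def)
  then show ?thesis
  proof cases
    case 1 with g show ?thesis by blast
  next
    case 2
    obtain N where N: "\<And>n. s (g N) \<le> s (g n)"
      using ex_has_least_nat[of "\<lambda>_. True" 0 "\<lambda>n. s (g n)"] by auto
    have "s (g (N + n)) = s (g N)" for n
      using N 2 by (intro antisym) auto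
    moreover have "strict_mono (\<lambda>n. g (N + n))"
      using g(1) by (simp add: strict_mono_def)
    ultimately show ?thesis by (intro exI[of _ "\<lambda>n. g (N + n)"]) auto
  qed
qed

text \<open>Dickson's lemma, by thinning the sequence for one coordinate after another until all
  coordinates are nondecreasing.\<close>

lemma dickson:
  fixes U :: "nat \<Rightarrow> 'n::finite \<Rightarrow> nat"
  shows "\<exists>t t'. t < t' \<and> U t \<le> U t'"
proof -
  have "\<exists>g :: nat \<Rightarrow> nat. strict_mono g \<and> (\<forall>j\<in>S. \<forall>m n. m \<le> n \<longrightarrow> U (g m) j \<le> U (g n) j)"
    if "finite S" for S
    using that
  proof (induction S)
    case empty
    show ?case by (rule exI[of _ "\<lambda>n::nat. n"]) (simp add: strict_mono_def)
  next
    case (insert i S)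
    then obtain g :: "nat \<Rightarrow> nat" where g: "strict_mono g"
      "\<forall>j\<in>S. \<forall>m n. m \<le> n \<longrightarrow> U (g m) j \<le> U (g n) j"
      by (elim exE conjE)
    obtain h :: "nat \<Rightarrow> nat" where h: "strict_mono h"
      "\<forall>m n. m \<le> n \<longrightarrow> U (g (h m)) i \<le> U (g (h n)) i"
      using nat_seq_mono_subseq[of "\<lambda>m. U (g m) i"] by (elim exE conjE)
    have "U (g (h m)) j \<le> U (g (h n)) j" if "j \<in> insert i S" "m \<le> n" for j m n
    proof -
      have "h m \<le> h n" using h(1) that(2) by (simp add: strict_mono_less_eq)
      then show ?thesis using g(2) h(2) that by (cases "j = i") auto
    qed
    moreover have "strict_mono (\<lambda>m. g (h m))" using g(1) h(1) by (simp add: strict_mono_def)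
    ultimately show ?case by (intro exI[of _ "\<lambda>m. g (h m)"]) simp
  qed
  from this[OF finite_class.finite_UNIV] obtain g :: "nat \<Rightarrow> nat" where g: "strict_mono g"
    "\<forall>j\<in>UNIV. \<forall>m n. m \<le> n \<longrightarrow> U (g m) j \<le> U (g n) j"
    by (elim exE conjE)
  then have "g 0 < g 1" "U (g 0) \<le> U (g 1)" by (auto simp: strict_mono_def le_fun_def)
  then show ?thesis by blast
qed

text \<open>Simultaneous approximation moved from the index set \<open>{0..<CARD('n)}\<close> to the
  type \<open>'n\<close>. It serves to replace real cone coefficients by fractions with one
  denominator \<open>N\<close>.\<close>

lemma dirichlet_approximation:
  fixes \<alpha> :: "'n::finite \<Rightarrow> real"
  assumes "\<epsilon> > 0"
  obtains N :: nat and q :: "'n \<Rightarrow> int"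
  where "N > 0" "\<And>j. \<bar>real N * \<alpha> j - of_int (q j)\<bar> < \<epsilon>"
proof -
  obtain h where h: "bij_betw h {0..<CARD('n)} (UNIV :: 'n set)"
    using ex_bij_betw_nat_finite[of "UNIV :: 'n set"] by auto
  obtain M :: nat where M: "M > 0" "1 / real M < \<epsilon>"
    using nat_approx_posE[OF assms] by (metis of_nat_Suc zero_less_Suc)
  obtain N q where N: "0 < (N :: int)"
    and q: "\<And>i. i < CARD('n) \<Longrightarrow> \<bar>of_int N * \<alpha> (h i) - of_int (q i)\<bar> < 1 / real M"
    using Dirichlet_approx_simult[OF M(1), of "CARD('n)" "\<lambda>i. \<alpha> (h i)"] by metis
  define h' where "h' = the_inv_into {0..<CARD('n)} h"
  have h': "h' j < CARD('n)" "h (h' j) = j" for j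
    using h the_inv_into_into[of h "{0..<CARD('n)}" j "{0..<CARD('n)}"]
      f_the_inv_into_f[of h "{0..<CARD('n)}" j]
    by (auto simp: bij_betw_def h'_def)
  show thesis
  proof (rule that[of "nat N" "\<lambda>j. q (h' j)"])
    show "\<bar>real (nat N) * \<alpha> j - of_int (q (h' j))\<bar> < \<epsilon>" for j
      using q[OF h'(1), of j] h'(2)[of j] M(2) N by simp
  qed (use N in simp)
qed

text \<open>The properties of standard monomials on which everything later rests. Neither the
  monomial order nor the field occurs again before the locale is instantiated.\<close>

locale standard_family =
  fixes A :: "int ^ 'n ^ 'd::finite" and p :: "'n::finite" and std :: "('n \<Rightarrow> nat) \<Rightarrow> bool"
  assumes column_p: "column p A = 0"
    and std_mono: "std u \<Longrightarrow> support v \<subseteq> support u \<Longrightarrow> std v"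
    and std_unique: "std u \<Longrightarrow> std v \<Longrightarrow> same_image A u v \<Longrightarrow> u = v"
    and std_exists: "\<exists>v. std v \<and> same_image A v u"
    and std_add_p: "std u \<Longrightarrow> std (u(p := u p + k))"
begin

definition reduced :: "('n \<Rightarrow> nat) \<Rightarrow> bool"
  where "reduced u \<longleftrightarrow> std u \<and> u p = 0"

text \<open>The subgroup of the integer vectors generated by the columns. The difference form
  supplies the two monomials \<open>s1\<close> and \<open>s2\<close> that \<open>std_dvd\<close>
  needs.\<close>

definition lattice :: "(int ^ 'd) set"
  where "lattice = {weight A s - weight A t | s t. True}"

lemma A_p [simp]: "A $ k $ p = 0"
  using column_p by (simp add: column_def vec_eq_iff)

lemma weight_at_p [simp]: "weight A (\<lambda>j. if j = p then k else 0) = 0"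
  by (simp add: weight_def vec_eq_iff if_distrib sum.delta' cong: if_cong)

lemma weight_upd_p [simp]: "weight A (u(p := k)) = weight A u"
proof -
  have "A $ i $ j * int ((u(p := k)) j) = A $ i $ j * int (u j)" for i j
    by (cases "j = p") auto
  then show ?thesis by (simp only: weight_def)
qed

lemma total_degree_at_p [simp]: "total_degree (\<lambda>j. if j = p then k else 0) = k"
  by (simp add: total_degree_def)

lemma total_degree_add_p: "total_degree (\<lambda>j. u j + (if j = p then k else 0)) = total_degree u + k"
  by simp

lemma upd_p_eq: "(u :: 'n \<Rightarrow> nat)(p := u p + k) = (\<lambda>j. u j + (if j = p then k else 0))"
  by (rule ext) simp

text \<open>The heart of normality: a standard monomial whose weight and degree are \<open>N\<close>
  times those of a difference \<open>s1 - s2\<close> is an \<open>N\<close>-th power. After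
  \<open>s1\<close> and \<open>s2\<close> are multiplied by a power of the squarefree monomial
  \<open>e\<close> on the support of \<open>w\<close>, their standard forms \<open>V\<close> and
  \<open>U t'\<close> satisfy \<open>N V = w + N U t'\<close>, by uniqueness of standard
  monomials.\<close>

lemma std_dvd:
  assumes N: "N > 0" and w: "std w"
    and weight_w: "weight A w = int N *s (weight A s1 - weight A s2)"
    and degree_w: "int (total_degree w) = int N * (int (total_degree s1) - int (total_degree s2))"
  shows "\<exists>u. w = (\<lambda>j. N * u j) \<and> weight A u = weight A s1 - weight A s2"
proof -
  define e :: "'n \<Rightarrow> nat" where "e = (\<lambda>j. if w j = 0 then 0 else 1)"
  have "\<forall>t. \<exists>v. std v \<and> same_image A v (\<lambda>j. s2 j + t * e j)"
    using std_exists by blast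
  then obtain U where U: "\<And>t. std (U t)" "\<And>t. same_image A (U t) (\<lambda>j. s2 j + t * e j)"
    by (auto dest!: choice)
  \<comment> \<open>The quotient of two comparable terms \<open>U t\<close> and \<open>U t'\<close>
    is a standard monomial with the image of a power of \<open>e\<close>, hence that power itself.
    So \<open>U t'\<close> involves every variable of \<open>w\<close>, which makes the product of
    \<open>w\<close> with a power of \<open>U t'\<close> standard.\<close>
  obtain t t' where t: "t < t'" "U t \<le> U t'" using dickson by blast
  then obtain s where s: "t' = t + s" "s > 0" by (metis less_imp_add_positive)
  define D where "D = (\<lambda>j. U t' j - U t j)"
  have Ut': "U t' = (\<lambda>j. D j + U t j)" using t(2) by (auto simp: D_def le_fun_def)
  have "std D" by (rule std_mono[OF U(1)[of t']]) (auto simp: support_def D_def)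
  moreover have "std (\<lambda>j. s * e j)"
    by (rule std_mono[OF w]) (auto simp: support_def e_def split: if_splits)
  moreover have "same_image A D (\<lambda>j. s * e j)"
  proof -
    have "weight A D + weight A (U t) = weight A (U t')" "total_degree D + total_degree (U t) = total_degree (U t')"
      by (simp_all add: Ut')
    then show ?thesis
      using U(2)[of t] U(2)[of t'] by (simp add: same_image_def s(1) algebra_simps)
  qed
  ultimately have D: "D = (\<lambda>j. s * e j)" by (rule std_unique)
  then have sub: "support w \<subseteq> support (U t')"
    using s(2) unfolding Ut' by (auto simp: support_def e_def)
  obtain V where V: "std V" "same_image A V (\<lambda>j. s1 j + t' * e j)"
    using std_exists by blast
  have "(\<lambda>j. N * V j) = (\<lambda>j. w j + N * U t' j)"
  proof (rule std_unique)
    show "std (\<lambda>j. N * V j)" by (rule std_mono[OF V(1)]) (auto simp: support_def)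
    show "std (\<lambda>j. w j + N * U t' j)"
      by (rule std_mono[OF U(1)[of t']]) (use sub in \<open>auto simp: support_def subset_iff\<close>)
    have "int N * (int (total_degree s1) - int (total_degree s2)) + int N * int (total_degree (U t')) =
        int N * int (total_degree V)"
      using V(2) U(2)[of t'] by (simp add: same_image_def algebra_simps)
    then have "int (total_degree w + N * total_degree (U t')) = int (N * total_degree V)"
      using degree_w by simp
    then show "same_image A (\<lambda>j. N * V j) (\<lambda>j. w j + N * U t' j)"
      using V(2) U(2)[of t'] weight_w
      unfolding same_image_def weight_add weight_mult total_degree_add total_degree_mult of_nat_eq_iff
      by (auto simp: vec_eq_iff algebra_simps)
  qed
  then have eq: "N * V j = w j + N * U t' j" for j by meson
  have w_eq: "w = (\<lambda>j. N * (V j - U t' j))"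
    using eq by (auto simp: diff_mult_distrib2)
  then have "weight A w = int N *s weight A (\<lambda>j. V j - U t' j)"
    by (metis weight_mult)
  then have "weight A (\<lambda>j. V j - U t' j) = weight A s1 - weight A s2"
    using weight_w N by (simp add: vec_eq_iff flip: right_diff_distrib)
  with w_eq show ?thesis by (intro exI conjI)
qed

lemma reduced_exists: "\<exists>v. reduced v \<and> weight A v = weight A u \<and> total_degree v \<le> total_degree u"
proof -
  obtain v where v: "std v" "same_image A v u" using std_exists by blast
  have "std (v(p := 0))" by (rule std_mono[OF v(1)]) (auto simp: support_def)
  moreover have "total_degree (v(p := 0)) \<le> total_degree v"
    unfolding total_degree_def by (rule sum_mono) auto
  ultimately show ?thesis using v(2)
    by (intro exI[of _ "v(p := 0)"]) (auto simp: reduced_def same_image_def)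
qed

text \<open>The weight alone identifies a reduced monomial: the one of smaller degree is padded with
  the variable \<open>p\<close>, of weight zero, and after that both lie in one fibre.\<close>

lemma reduced_unique:
  assumes "reduced u" "reduced v" "weight A u = weight A v"
  shows "u = v"
proof -
  have *: "u = v" if "reduced u" "reduced v" "weight A u = weight A v" "total_degree u \<le> total_degree v" for u v
  proof -
    let ?u = "u(p := u p + (total_degree v - total_degree u))"
    have "total_degree ?u = total_degree v"
      unfolding upd_p_eq total_degree_add_p using that(4) by simp
    then have "same_image A ?u v" using that(3) by (simp add: same_image_def)
    moreover have "std ?u" using that(1) by (intro std_add_p) (simp add: reduced_def)
    ultimately have "?u = v" using that(2) by (intro std_unique) (auto simp: reduced_def)
    then show ?thesis using that(1,2)
      by (metis add_is_0 fun_upd_same fun_upd_triv reduced_def)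
  qed
  show ?thesis using *[of u v] *[of v u] assms by (metis nle_le)
qed

lemma reduced_mono: "reduced u \<Longrightarrow> support v \<subseteq> support u \<Longrightarrow> reduced v"
  using std_mono by (auto simp: reduced_def support_def subset_iff)

text \<open>The coefficients are approximated by \<open>q / N\<close> so closely that
  \<open>A q = N z\<close> exactly, while the degree of \<open>q\<close> stays below
  \<open>N\<close> times the next integer above the sum of \<open>\<alpha>\<close>. The reduced
  monomial of weight \<open>N z\<close> is then an \<open>N\<close>-th power by
  \<open>std_dvd\<close>, and its root is the desired monomial.\<close>

lemma lattice_cone_point:
  assumes z: "z \<in> lattice" and \<alpha>: "\<And>j. \<alpha> j \<ge> (0 :: real)"
    and eq: "\<And>k. real_of_int (z $ k) = (\<Sum>j\<in>UNIV. of_int (A $ k $ j) * \<alpha> j)"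
  shows "\<exists>u. reduced u \<and> weight A u = z \<and> real (total_degree u) \<le> sum \<alpha> UNIV"
proof -
  \<comment> \<open>\<open>\<delta>\<close> is the room between the coefficient sum and the next
    larger integer. \<open>M\<close> exceeds every row sum of absolute values and the number of
    columns, so an error below \<open>\<delta> / M\<close> per coefficient accumulates to less than
    1 in each coordinate and to less than \<open>\<delta>\<close> in the sum.\<close>
  define \<delta> where "\<delta> = of_int (\<lfloor>sum \<alpha> UNIV\<rfloor> + 1) - sum \<alpha> UNIV"
  have \<delta>: "0 < \<delta>" "\<delta> \<le> 1" unfolding \<delta>_def by linarith+
  define M where "M = (\<Sum>k\<in>UNIV. \<Sum>j\<in>UNIV. real_of_int \<bar>A $ k $ j\<bar>) + real CARD('n) + 1"
  have row: "(\<Sum>j\<in>UNIV. real_of_int \<bar>A $ k $ j\<bar>) \<le> (\<Sum>k\<in>UNIV. \<Sum>j\<in>UNIV. real_of_int \<bar>A $ k $ j\<bar>)" for k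
    by (rule member_le_sum[of k UNIV "\<lambda>k. \<Sum>j\<in>UNIV. real_of_int \<bar>A $ k $ j\<bar>"]) (auto intro: sum_nonneg)
  have tot: "0 \<le> (\<Sum>k\<in>UNIV. \<Sum>j\<in>UNIV. real_of_int \<bar>A $ k $ j\<bar>)"
    by (intro sum_nonneg) auto
  have M: "M > 0" "(\<Sum>j\<in>UNIV. real_of_int \<bar>A $ k $ j\<bar>) < M" "real CARD('n) < M" "1 \<le> M" for k
    using row[of k] tot by (auto simp: M_def)
  have "\<delta> / M > 0" using \<delta> M by simp
  from dirichlet_approximation[OF this, of \<alpha>] obtain N q where N: "N > 0"
    and q: "\<And>j. \<bar>real N * \<alpha> j - of_int (q j)\<bar> < \<delta> / M" by blast
  have q0: "q j \<ge> 0" for j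
  proof -
    have "\<delta> / M \<le> 1" using \<delta> M(4) M(1) by (simp add: divide_le_eq)
    moreover have "0 \<le> real N * \<alpha> j" using \<alpha> by simp
    ultimately have "-1 < real_of_int (q j)" using q[of j] by linarith
    then show ?thesis by linarith
  qed
  define h where "h = (\<lambda>j. nat (q j))"
  have h: "int (h j) = q j" for j using q0 by (simp add: h_def)
  have weight_h: "weight A h = int N *s z"
  proof -
    have "(\<Sum>j\<in>UNIV. A $ k $ j * q j) = int N * z $ k" for k
    proof -
      \<comment> \<open>Both sides are integers, so a distance below 1 forces equality.\<close>
      have "real_of_int (int N * z $ k - (\<Sum>j\<in>UNIV. A $ k $ j * q j)) =
          (\<Sum>j\<in>UNIV. of_int (A $ k $ j) * (real N * \<alpha> j - of_int (q j)))"
        by (simp add: eq algebra_simps sum_distrib_left sum_subtractf)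
      also have "\<bar>\<dots>\<bar> \<le> (\<Sum>j\<in>UNIV. of_int \<bar>A $ k $ j\<bar> * (\<delta> / M))"
        by (rule order_trans[OF sum_abs], rule sum_mono, unfold abs_mult of_int_abs)
          (intro mult_left_mono less_imp_le[OF q] abs_ge_zero)
      also have "\<dots> = (\<Sum>j\<in>UNIV. of_int \<bar>A $ k $ j\<bar>) * (\<delta> / M)"
        by (simp only: sum_distrib_right)
      also have "\<dots> < M * (\<delta> / M)"
        using M \<delta> by (intro mult_strict_right_mono) auto
      also have "\<dots> \<le> 1" using M(1) \<delta> by simp
      finally show ?thesis by linarith
    qed
    then show ?thesis by (simp add: weight_def vec_eq_iff h)
  qed
  have deg_h: "int (total_degree h) < int N * (\<lfloor>sum \<alpha> UNIV\<rfloor> + 1)"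
  proof -
    have "real (total_degree h) = (\<Sum>j\<in>UNIV. real_of_int (q j))"
      using h by (simp add: total_degree_def) (metis of_int_of_nat_eq)
    also have "\<dots> \<le> (\<Sum>j\<in>UNIV. real N * \<alpha> j + \<delta> / M)"
      by (rule sum_mono) (use q in \<open>smt (verit, best)\<close>)
    also have "\<dots> = real N * sum \<alpha> UNIV + real CARD('n) * (\<delta> / M)"
      by (simp add: sum.distrib sum_distrib_left)
    also have "real CARD('n) * (\<delta> / M) < M * (\<delta> / M)"
      using M \<delta> by (intro mult_strict_right_mono) auto
    also have "M * (\<delta> / M) \<le> real N * \<delta>" using M(1) \<delta> N by simp
    also have "real N * sum \<alpha> UNIV + real N * \<delta> = real N * of_int (\<lfloor>sum \<alpha> UNIV\<rfloor> + 1)"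
      by (simp add: \<delta>_def algebra_simps)
    finally have "real_of_int (int (total_degree h)) < of_int (int N * (\<lfloor>sum \<alpha> UNIV\<rfloor> + 1))" by simp
    then show ?thesis by linarith
  qed
  obtain w where w: "reduced w" "weight A w = weight A h" "total_degree w \<le> total_degree h"
    using reduced_exists by blast
  define l where "l = total_degree w"
  have Nl: "l \<le> N * l" using N by simp
  obtain s1 s2 where s: "z = weight A s1 - weight A s2" using z by (auto simp: lattice_def)
  \<comment> \<open>Padding with the variable \<open>p\<close> leaves weights alone and makes the
    degrees of \<open>?s1\<close> and \<open>?s2\<close> differ by exactly \<open>l\<close>, to
    match the degree \<open>N * l\<close> given to \<open>?w\<close>.\<close>
  let ?s1 = "\<lambda>j. s1 j + (if j = p then l + total_degree s2 else 0)"
  let ?s2 = "\<lambda>j. s2 j + (if j = p then total_degree s1 else 0)"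
  let ?w = "w(p := w p + (N * l - l))"
  have "\<exists>u. ?w = (\<lambda>j. N * u j) \<and> weight A u = weight A ?s1 - weight A ?s2"
  proof (rule std_dvd[OF N])
    show "std ?w" using w(1) by (intro std_add_p) (simp add: reduced_def)
    show "weight A ?w = int N *s (weight A ?s1 - weight A ?s2)"
      by (simp add: w(2) weight_h s)
    have "total_degree ?w = N * l"
      unfolding upd_p_eq total_degree_add_p using Nl l_def by simp
    then show "int (total_degree ?w) = int N * (int (total_degree ?s1) - int (total_degree ?s2))"
      by simp
  qed
  then obtain u where u: "?w = (\<lambda>j. N * u j)" "weight A u = z" by (auto simp: s)
  have w_eq: "w = (\<lambda>j. N * (u(p := 0)) j)"
  proof
    fix j show "w j = N * (u(p := 0)) j"
      using fun_cong[OF u(1), of j] w(1) by (cases "j = p") (auto simp: reduced_def)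
  qed
  have "reduced (u(p := 0))"
  proof (rule reduced_mono[OF w(1)], rule subsetI)
    fix j assume "j \<in> support (u(p := 0))"
    then show "j \<in> support w"
      using fun_cong[OF w_eq, of j] N by (simp add: support_def del: fun_upd_apply)
  qed
  moreover have "real (total_degree (u(p := 0))) \<le> sum \<alpha> UNIV"
  proof -
    have "total_degree w = N * total_degree (u(p := 0))"
      using arg_cong[OF w_eq, of total_degree] unfolding total_degree_mult .
    then have "int N * int (total_degree (u(p := 0))) \<le> int (total_degree h)"
      using w(3) by (simp flip: of_nat_mult)
    then have "int N * int (total_degree (u(p := 0))) < int N * (\<lfloor>sum \<alpha> UNIV\<rfloor> + 1)"
      using deg_h by (rule order_le_less_trans)
    then have "int (total_degree (u(p := 0))) \<le> \<lfloor>sum \<alpha> UNIV\<rfloor>"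
      using N by (simp add: mult_less_cancel_left_pos)
    then show ?thesis by linarith
  qed
  ultimately show ?thesis using u(2) by (intro exI[of _ "u(p := 0)"]) auto
qed

end

lemma standard_family_standard:
  fixes A :: "int ^ 'n ^ 'd::finite"
  assumes "column p A = 0" and r: "strict_linear_order_on UNIV r"
    and sq: "squarefree_ideal (initial_ideal r (toric_ideal A :: ('n::finite, 'k::field) mpolynomial set))"
    and p: "\<And>i. i \<noteq> p \<Longrightarrow> (p, i) \<in> r"
  shows "standard_family A p (standard r A)"
proof
  show "column p A = 0" by fact
  show "standard r A v" if "standard r A u" "support v \<subseteq> support u" for u v
    using sq that by (rule standard_support_mono)
  show "u = v" if "standard r A u" "standard r A v" "same_image A u v" for u v
    using r that by (rule standard_unique)
  show "\<exists>v. standard r A v \<and> same_image A v u" for u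
    by (rule standard_exists[OF r, of A u]) blast
  show "standard r A (u(p := u p + k))" if "standard r A u" for u k
    using r p that by (rule standard_add_least)
qed

section \<open>Harmony\<close>

lemma of_harmony_sym:
  fixes A :: "int ^ 'n::finite ^ 'd::finite" and B :: "int ^ 'm::finite ^ 'd"
  assumes h: "of_harmony A B"
  shows "of_harmony B A"
proof -
  have "pos_part_vec (b - a) = neg_part_vec (a - b)" "neg_part_vec (b - a) = pos_part_vec (a - b)" for a b :: "int ^ 'd"
    by (simp_all add: pos_part_vec_def neg_part_vec_def)
  note parts = this
  show ?thesis
    unfolding of_harmony_def
  proof (intro conjI ballI)
    show "nonneg_matrix B" "nonneg_matrix A" "0 \<in> columns B" "0 \<in> columns A"
      using h by (simp_all add: of_harmony_def)
    fix b a assume "b \<in> columns B" "a \<in> columns A"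
    then have "pos_part_vec (a - b) \<in> columns A" "neg_part_vec (a - b) \<in> columns B"
      using h by (simp_all add: of_harmony_def)
    then show "pos_part_vec (b - a) \<in> columns B" "neg_part_vec (b - a) \<in> columns A"
      by (simp_all only: parts(1)[of b a] parts(2)[of b a])
  qed
qed

lemma of_harmonyE:
  fixes A :: "int ^ 'n::finite ^ 'd::finite" and B :: "int ^ 'm::finite ^ 'd"
  assumes "of_harmony A B"
  obtains i' j' where "\<And>k. A $ k $ i' = max 0 (A $ k $ i - B $ k $ j)"
    "\<And>k. B $ k $ j' = max 0 (B $ k $ j - A $ k $ i)"
proof -
  have "pos_part_vec (column i A - column j B) \<in> columns A" "neg_part_vec (column i A - column j B) \<in> columns B"
    using assms unfolding of_harmony_def by (auto simp: columns_def)
  then obtain i' j' where "pos_part_vec (column i A - column j B) = column i' A"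
    "neg_part_vec (column i A - column j B) = column j' B"
    by (auto simp: columns_def)
  then have "\<And>k. A $ k $ i' = max 0 (A $ k $ i - B $ k $ j)" "\<And>k. B $ k $ j' = max 0 (B $ k $ j - A $ k $ i)"
    by (simp_all add: pos_part_vec_def neg_part_vec_def column_def vec_eq_iff)
  then show thesis by (rule that)
qed

lemma harmony_nonneg:
  assumes "of_harmony A B"
  shows "A $ k $ i \<ge> 0" "B $ k $ j \<ge> 0"
  using assms by (auto simp: of_harmony_def nonneg_matrix_def)

text \<open>\<open>weight\<close> with real coefficients; its values at nonnegative
  \<open>\<alpha>\<close> form the cone over the columns.\<close>

definition cone_map :: "int ^ 'n ^ 'd \<Rightarrow> ('n::finite \<Rightarrow> real) \<Rightarrow> 'd::finite \<Rightarrow> real"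
  where "cone_map A \<alpha> k = (\<Sum>j\<in>UNIV. of_int (A $ k $ j) * \<alpha> j)"

text \<open>Shifts the amount \<open>e\<close> from column \<open>i\<close> to column
  \<open>i'\<close>. Written with summands in place of function updates, it also covers
  \<open>i = i'\<close>.\<close>

lemma cone_map_exchange:
  "cone_map A (\<lambda>l. \<alpha> l + (if l = i' then e else 0) - (if l = i then e else 0)) k =
    cone_map A \<alpha> k + e * (of_int (A $ k $ i') - of_int (A $ k $ i))"
proof -
  have *: "of_int (A $ k $ l) * (\<alpha> l + (if l = i' then e else 0) - (if l = i then e else 0)) =
    of_int (A $ k $ l) * \<alpha> l + (if l = i' then of_int (A $ k $ l) * e else 0)
      - (if l = i then of_int (A $ k $ l) * e else 0)" for l
    by (auto simp: algebra_simps)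
  show ?thesis
    unfolding cone_map_def * by (simp add: sum.distrib sum_subtractf right_diff_distrib mult.commute)
qed

lemma sum_exchange:
  fixes \<alpha> :: "'n::finite \<Rightarrow> real"
  shows "(\<Sum>l\<in>UNIV. \<alpha> l + (if l = i' then e else 0) - (if l = i then e else 0)) = sum \<alpha> UNIV"
  by (simp add: sum.distrib sum_subtractf)

lemma cone_map_nonneg: "nonneg_matrix A \<Longrightarrow> (\<And>j. \<alpha> j \<ge> 0) \<Longrightarrow> cone_map A \<alpha> k \<ge> 0"
  unfolding cone_map_def nonneg_matrix_def by (intro sum_nonneg mult_nonneg_nonneg) auto

lemma cone_map_pos_obtain:
  assumes "cone_map A \<alpha> k \<noteq> 0"
  obtains j where "A $ k $ j \<noteq> 0" "\<alpha> j \<noteq> 0"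
proof -
  have "\<exists>j. of_int (A $ k $ j) * \<alpha> j \<noteq> 0"
    using assms unfolding cone_map_def by (meson sum.neutral)
  then show thesis using that by auto
qed

text \<open>
  Among all representations \<open>x = A\<alpha> - B\<beta>\<close> with prescribed coefficient sums, one that minimises the
  total size of \<open>A\<alpha> + B\<beta>\<close> has \<open>A\<alpha>\<close> and \<open>B\<beta>\<close> of disjoint support, since otherwise harmony allows
  to replace a column \<open>a\<close> of \<open>A\<close> and an overlapping column \<open>b\<close> of \<open>B\<close> by the two parts of \<open>a - b\<close>.
\<close>

lemma harmony_decomposition:
  fixes A :: "int ^ 'n::finite ^ 'd::finite" and B :: "int ^ 'm::finite ^ 'd"
  assumes harm: "of_harmony A B" and nn: "\<And>i. \<alpha> i \<ge> 0" "\<And>j. \<beta> j \<ge> 0"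
    and x: "\<And>k. x k = cone_map A \<alpha> k - cone_map B \<beta> k"
  shows "\<exists>\<alpha>' \<beta>'. (\<forall>i. \<alpha>' i \<ge> 0) \<and> (\<forall>j. \<beta>' j \<ge> 0) \<and> sum \<alpha>' UNIV = sum \<alpha> UNIV \<and>
    sum \<beta>' UNIV = sum \<beta> UNIV \<and> (\<forall>k. cone_map A \<alpha>' k = max 0 (x k)) \<and> (\<forall>k. cone_map B \<beta>' k = max 0 (- x k))"
proof -
  define good :: "(real ^ 'n) \<times> (real ^ 'm) \<Rightarrow> bool" where
    "good = (\<lambda>y. (\<forall>i. 0 \<le> fst y $ i) \<and> (\<forall>j. 0 \<le> snd y $ j) \<and>
      (\<Sum>i\<in>UNIV. fst y $ i) = sum \<alpha> UNIV \<and> (\<Sum>j\<in>UNIV. snd y $ j) = sum \<beta> UNIV \<and>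
      (\<forall>k. cone_map A (\<lambda>i. fst y $ i) k - cone_map B (\<lambda>j. snd y $ j) k = x k))"
  define size where "size = (\<lambda>y :: (real ^ 'n) \<times> (real ^ 'm).
      \<Sum>k\<in>UNIV. cone_map A (\<lambda>i. fst y $ i) k + cone_map B (\<lambda>j. snd y $ j) k)"
  \<comment> \<open>The prescribed sums bound the nonnegative coefficients, so the representations
    form a compact set and \<open>size\<close> attains its minimum.\<close>
  have compact: "compact (Collect good)"
  proof -
    have "closed (Collect good)"
      unfolding good_def cone_map_def
      by (intro closed_Collect_conj closed_Collect_all closed_Collect_le closed_Collect_eq continuous_intros)
    moreover have "compact (cbox (0 :: real ^ 'n) (\<chi> i. sum \<alpha> UNIV) \<times> cbox (0 :: real ^ 'm) (\<chi> j. sum \<beta> UNIV))"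
      by (intro compact_Times compact_cbox)
    moreover have "Collect good \<subseteq> cbox (0 :: real ^ 'n) (\<chi> i. sum \<alpha> UNIV) \<times> cbox (0 :: real ^ 'm) (\<chi> j. sum \<beta> UNIV)"
    proof
      fix y assume "y \<in> Collect good"
      then have y: "\<And>i. 0 \<le> fst y $ i" "\<And>j. 0 \<le> snd y $ j"
        "(\<Sum>i\<in>UNIV. fst y $ i) = sum \<alpha> UNIV" "(\<Sum>j\<in>UNIV. snd y $ j) = sum \<beta> UNIV"
        by (auto simp: good_def)
      have "fst y $ i \<le> sum \<alpha> UNIV" for i
        unfolding y(3)[symmetric] by (rule member_le_sum) (use y in auto)
      moreover have "snd y $ j \<le> sum \<beta> UNIV" for j
        unfolding y(4)[symmetric] by (rule member_le_sum) (use y in auto)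
      ultimately show "y \<in> cbox (0 :: real ^ 'n) (\<chi> i. sum \<alpha> UNIV) \<times> cbox (0 :: real ^ 'm) (\<chi> j. sum \<beta> UNIV)"
        using y by (auto simp: mem_box_cart mem_Times_iff)
    qed
    ultimately show ?thesis by (metis compact_Int_closed inf.absorb2)
  qed
  have "good (\<chi> i. \<alpha> i, \<chi> j. \<beta> j)"
    using nn x by (simp add: good_def cone_map_def)
  then have ne: "Collect good \<noteq> {}" by auto
  have cont: "continuous_on (Collect good) size"
    unfolding size_def cone_map_def by (intro continuous_intros)
  obtain y where y: "good y" and least: "\<And>z. good z \<Longrightarrow> size y \<le> size z"
    using continuous_attains_inf[OF compact ne cont] by auto
  define a where "a = (\<lambda>i. fst y $ i)"
  define b where "b = (\<lambda>j. snd y $ j)"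
  have ab: "\<And>i. a i \<ge> 0" "\<And>j. b j \<ge> 0" "sum a UNIV = sum \<alpha> UNIV" "sum b UNIV = sum \<beta> UNIV"
    "\<And>k. cone_map A a k - cone_map B b k = x k"
    using y by (auto simp: good_def a_def b_def)
  have nonneg: "cone_map A a k \<ge> 0" "cone_map B b k \<ge> 0" for k
    using harm ab(1,2) by (auto simp: of_harmony_def intro: cone_map_nonneg)
  have disj: "cone_map A a k = 0 \<or> cone_map B b k = 0" for k
  proof (rule ccontr)
    assume "\<not> ?thesis"
    then obtain i j where i: "A $ k $ i \<noteq> 0" "a i \<noteq> 0" and j: "B $ k $ j \<noteq> 0" "b j \<noteq> 0"
      by (meson cone_map_pos_obtain)
    obtain i' j' where i': "\<And>k. A $ k $ i' = max 0 (A $ k $ i - B $ k $ j)"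
      and j': "\<And>k. B $ k $ j' = max 0 (B $ k $ j - A $ k $ i)"
      by (rule of_harmonyE[OF harm, of i j]) blast
    \<comment> \<open>The largest amount that can be taken from both columns with the coefficients
      staying nonnegative.\<close>
    define e where "e = min (a i) (b j)"
    have e: "e > 0" "e \<le> a i" "e \<le> b j"
      using ab(1)[of i] ab(2)[of j] i j by (auto simp: e_def)
    define a' where "a' = (\<lambda>l. a l + (if l = i' then e else 0) - (if l = i then e else 0))"
    define b' where "b' = (\<lambda>l. b l + (if l = j' then e else 0) - (if l = j then e else 0))"
    have a': "cone_map A a' k = cone_map A a k + e * (of_int (A $ k $ i') - of_int (A $ k $ i))"
      and b': "cone_map B b' k = cone_map B b k + e * (of_int (B $ k $ j') - of_int (B $ k $ j))" for k
      unfolding a'_def b'_def by (rule cone_map_exchange)+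
    have diff: "cone_map A a' k - cone_map B b' k = x k" for k
    proof -
      \<comment> \<open>As \<open>a - b\<close> is the difference of its two parts, both sides
        change by the same vector and \<open>x\<close> is still represented.\<close>
      have "real_of_int (A $ k $ i') - of_int (A $ k $ i) = of_int (B $ k $ j') - of_int (B $ k $ j)"
        unfolding i' j' by (auto simp: max_def)
      then show ?thesis using ab(5)[of k] by (simp add: a' b')
    qed
    have less: "cone_map A a' l + cone_map B b' l \<le> cone_map A a l + cone_map B b l" for l
      unfolding a' b' i' j' using e(1) harmony_nonneg(1)[OF harm, of l i] harmony_nonneg(2)[OF harm, of l j]
      by (auto simp: max_def mult_le_0_iff add_nonpos_nonpos)
    have strict: "cone_map A a' k + cone_map B b' k < cone_map A a k + cone_map B b k"
    proof -
      have pos: "A $ k $ i > 0" "B $ k $ j > 0"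
        using harmony_nonneg(1)[OF harm, of k i] harmony_nonneg(2)[OF harm, of k j] i j by (auto simp: order_less_le)
      have "e * (of_int (A $ k $ i') - of_int (A $ k $ i)) < 0"
        unfolding i' using e(1) pos by (intro mult_pos_neg) (auto simp: max_def)
      moreover have "e * (of_int (B $ k $ j') - of_int (B $ k $ j)) < 0"
        unfolding j' using e(1) pos by (intro mult_pos_neg) (auto simp: max_def)
      ultimately show ?thesis unfolding a' b' by linarith
    qed
    have "a' l \<ge> 0" "b' m \<ge> 0" for l m
      using ab(1)[of l] ab(2)[of m] e by (auto simp: a'_def b'_def)
    moreover have "sum a' UNIV = sum \<alpha> UNIV" "sum b' UNIV = sum \<beta> UNIV"
      unfolding a'_def b'_def sum_exchange by (rule ab)+
    ultimately have "good (\<chi> i. a' i, \<chi> j. b' j)"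
      using diff by (simp add: good_def cone_map_def)
    from least[OF this] have "(\<Sum>k\<in>UNIV. cone_map A a k + cone_map B b k) \<le> (\<Sum>k\<in>UNIV. cone_map A a' k + cone_map B b' k)"
      by (simp add: size_def a_def b_def cone_map_def)
    moreover have "(\<Sum>k\<in>UNIV. cone_map A a' k + cone_map B b' k) < (\<Sum>k\<in>UNIV. cone_map A a k + cone_map B b k)"
    proof (rule sum_strict_mono_ex1)
      show "\<forall>l\<in>UNIV. cone_map A a' l + cone_map B b' l \<le> cone_map A a l + cone_map B b l"
        using less by (intro ballI)
      show "\<exists>l\<in>UNIV. cone_map A a' l + cone_map B b' l < cone_map A a l + cone_map B b l"
        using strict by (intro bexI[of _ k]) auto
    qed simp
    ultimately show False by simp
  qed
  have "cone_map A a k = max 0 (x k) \<and> cone_map B b k = max 0 (- x k)" for k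
    using disj[of k] nonneg[of k] ab(5)[of k] by auto
  with ab show ?thesis by (intro exI[of _ a] exI[of _ b]) simp
qed

text \<open>The coordinates in which the cone over the columns of \<open>A\<close> can be nonzero.
  Restricting to them is how contributions of \<open>B\<close> are pulled back into the lattice of
  \<open>A\<close>.\<close>

definition row_support :: "int ^ 'n ^ 'd \<Rightarrow> 'd set"
  where "row_support A = {k. \<exists>j. A $ k $ j \<noteq> 0}"

definition restrict_vec :: "'d set \<Rightarrow> int ^ 'd \<Rightarrow> int ^ 'd"
  where "restrict_vec S z = (\<chi> k. if k \<in> S then z $ k else 0)"

section \<open>Restricting the lattice of one matrix to the coordinates of the other\<close>

context standard_family
begin

lemma latticeI: "z = weight A s - weight A t \<Longrightarrow> z \<in> lattice"
  unfolding lattice_def by blast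

lemma lattice_add: "y \<in> lattice \<Longrightarrow> z \<in> lattice \<Longrightarrow> y + z \<in> lattice"
proof -
  assume "y \<in> lattice" "z \<in> lattice"
  then obtain s t s' t' where "y = weight A s - weight A t" "z = weight A s' - weight A t'"
    by (auto simp: lattice_def)
  then have "y + z = weight A (\<lambda>j. s j + s' j) - weight A (\<lambda>j. t j + t' j)" by simp
  then show ?thesis by (rule latticeI)
qed

lemma lattice_minus: "z \<in> lattice \<Longrightarrow> - z \<in> lattice"
proof -
  assume "z \<in> lattice"
  then obtain s t where "z = weight A s - weight A t" by (auto simp: lattice_def)
  then have "- z = weight A t - weight A s" by simp
  then show ?thesis by (rule latticeI)
qed

lemma weight_zero [simp]: "weight A (\<lambda>_. 0) = 0"
  by (simp add: weight_def vec_eq_iff)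

lemma weight_in_lattice: "weight A u \<in> lattice"
proof -
  have "weight A u = weight A u - weight A (\<lambda>_. 0)" by simp
  then show ?thesis by (rule latticeI)
qed

lemma column_in_lattice: "column j A \<in> lattice"
proof -
  have "weight A (\<lambda>l. if l = j then 1 else 0) = column j A"
    by (simp add: weight_def column_def vec_eq_iff if_distrib sum.delta' cong: if_cong)
  then show ?thesis using weight_in_lattice[of "\<lambda>l. if l = j then 1 else 0"] by simp
qed

lemma zero_in_lattice: "0 \<in> lattice"
  using weight_in_lattice[of "\<lambda>_. 0"] by simp

lemma lattice_sum: "(\<And>i. i \<in> I \<Longrightarrow> f i \<in> lattice) \<Longrightarrow> sum f I \<in> lattice"
  by (induction I rule: infinite_finite_induct) (auto intro: lattice_add zero_in_lattice)

lemma lattice_scale_nat: "z \<in> lattice \<Longrightarrow> int n *s z \<in> lattice"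
proof (induction n)
  case 0
  have "int 0 *s z = 0" by (simp add: vec_eq_iff)
  then show ?case using zero_in_lattice by simp
next
  case (Suc n)
  have "int (Suc n) *s z = z + int n *s z" by (simp add: vec_eq_iff algebra_simps)
  then show ?case using Suc by (simp only: lattice_add)
qed

lemma restrict_lattice: "z \<in> lattice \<Longrightarrow> restrict_vec (row_support A) z = z"
  by (auto simp: lattice_def restrict_vec_def row_support_def weight_def vec_eq_iff)

text \<open>Induction on the entry sum of the column \<open>b\<close>. If \<open>b\<close> overlaps
  a column \<open>a\<close> of \<open>A\<close>, harmony gives \<open>b = b' + (a - a')\<close> with
  \<open>a'\<close> and \<open>b'\<close> the two parts of \<open>a - b\<close>, and
  \<open>b'\<close> has smaller sum; if it overlaps none, its restriction is zero.\<close>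

lemma restrict_column_in_lattice:
  fixes B :: "int ^ 'm::finite ^ 'd"
  assumes harm: "of_harmony A B"
  shows "restrict_vec (row_support A) (column j B) \<in> lattice"
proof (induction "nat (\<Sum>k\<in>UNIV. B $ k $ j)" arbitrary: j rule: less_induct)
  case less
  show ?case
  proof (cases "\<exists>k i. A $ k $ i \<noteq> 0 \<and> B $ k $ j \<noteq> 0")
    case False
    then have "restrict_vec (row_support A) (column j B) = 0"
      by (auto simp: restrict_vec_def row_support_def column_def vec_eq_iff)
    then show ?thesis using zero_in_lattice by simp
  next
    case True
    then obtain k i where ki: "A $ k $ i \<noteq> 0" "B $ k $ j \<noteq> 0" by blast
    obtain i' j' where i': "\<And>k. A $ k $ i' = max 0 (A $ k $ i - B $ k $ j)"
      and j': "\<And>k. B $ k $ j' = max 0 (B $ k $ j - A $ k $ i)"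
      by (rule of_harmonyE[OF harm, of i j]) blast
    note nn = harmony_nonneg[OF harm]
    have "(\<Sum>k\<in>UNIV. B $ k $ j') < (\<Sum>k\<in>UNIV. B $ k $ j)"
    proof (rule sum_strict_mono_ex1)
      show "\<forall>k\<in>UNIV. B $ k $ j' \<le> B $ k $ j" using nn by (auto simp: j')
      have "B $ k $ j' < B $ k $ j"
        using nn(1)[of k i] nn(2)[of k j] ki unfolding j' by linarith
      then show "\<exists>k\<in>UNIV. B $ k $ j' < B $ k $ j" by blast
    qed simp
    moreover have "(\<Sum>k\<in>UNIV. B $ k $ j') \<ge> 0" by (intro sum_nonneg) (simp add: nn)
    ultimately have "restrict_vec (row_support A) (column j' B) \<in> lattice"
      by (intro less.hyps) simp
    moreover have "column i A - column i' A \<in> lattice"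
      using lattice_add[OF column_in_lattice lattice_minus[OF column_in_lattice]] by simp
    moreover have "restrict_vec (row_support A) (column j B) =
        restrict_vec (row_support A) (column j' B) + (column i A - column i' A)"
    proof -
      have "B $ k $ j = B $ k $ j' + (A $ k $ i - A $ k $ i')" for k
        unfolding i' j' by linarith
      then show ?thesis
        by (auto simp: restrict_vec_def row_support_def column_def vec_eq_iff)
    qed
    ultimately show ?thesis by (simp only: lattice_add)
  qed
qed

lemma restrict_weight_in_lattice:
  fixes B :: "int ^ 'm::finite ^ 'd"
  assumes "of_harmony A B"
  shows "restrict_vec (row_support A) (weight B v) \<in> lattice"
proof -
  have "restrict_vec (row_support A) (weight B v) =
      (\<Sum>j\<in>UNIV. int (v j) *s restrict_vec (row_support A) (column j B))"
    by (simp add: restrict_vec_def weight_def column_def vec_eq_iff algebra_simps)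
  then show ?thesis
    by (simp only:) (intro lattice_sum lattice_scale_nat restrict_column_in_lattice[OF assms])
qed

end

text \<open>\<open>spanning\<close> is the form in which the lattice hypothesis on Gamma enters;
  \<open>lattice_sum_spanning\<close> derives it.\<close>

locale harmony_pair =
  FA: standard_family A p stdA + FB: standard_family B q stdB
  for A :: "int ^ 'n::finite ^ 'd::finite" and p stdA and B :: "int ^ 'm::finite ^ 'd" and q stdB +
  assumes harmony: "of_harmony A B"
    and spanning: "\<exists>a\<in>FA.lattice. \<exists>b\<in>FB.lattice. z = a + b"
begin

text \<open>A point of the cone vanishes outside \<open>row_support A\<close>, so it equals its own
  restriction. Restricting its decomposition from \<open>spanning\<close> shows that it lies in the
  lattice of \<open>A\<close>, where \<open>lattice_cone_point\<close> applies.\<close>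

lemma cone_point_A:
  assumes \<alpha>: "\<And>i. \<alpha> i \<ge> (0 :: real)" and z: "\<And>k. real_of_int (z $ k) = cone_map A \<alpha> k"
  shows "\<exists>u. FA.reduced u \<and> weight A u = z \<and> real (total_degree u) \<le> sum \<alpha> UNIV"
proof -
  obtain a s t where a: "a \<in> FA.lattice" and z_eq: "z = a + (weight B s - weight B t)"
    using spanning[of z] by (auto simp: FB.lattice_def)
  have "z = restrict_vec (row_support A) z"
  proof -
    have "z $ k = 0" if "k \<notin> row_support A" for k
      using z[of k] that by (simp add: cone_map_def row_support_def)
    then show ?thesis by (auto simp: restrict_vec_def vec_eq_iff)
  qed
  also have "\<dots> = restrict_vec (row_support A) a +
      (restrict_vec (row_support A) (weight B s) + - restrict_vec (row_support A) (weight B t))"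
    unfolding z_eq by (simp add: restrict_vec_def vec_eq_iff)
  also have "\<dots> \<in> FA.lattice"
    using FA.restrict_lattice[OF a] a FA.restrict_weight_in_lattice[OF harmony]
    by (intro FA.lattice_add FA.lattice_minus) auto
  finally show ?thesis using FA.lattice_cone_point[of z \<alpha>] \<alpha> z unfolding cone_map_def by blast
qed

end

lemma harmony_pair_sym:
  assumes "harmony_pair A p stdA B q stdB"
  shows "harmony_pair B q stdB A p stdA"
proof -
  interpret harmony_pair A p stdA B q stdB by fact
  show ?thesis
  proof
    show "of_harmony B A" by (rule of_harmony_sym[OF harmony])
    show "\<exists>a\<in>FB.lattice. \<exists>b\<in>FA.lattice. z = a + b" for z
    proof -
      obtain a b where "a \<in> FA.lattice" "b \<in> FB.lattice" "z = a + b"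
        using spanning[of z] by (elim bexE)
      then show ?thesis by (intro bexI[of _ b] bexI[of _ a]) (simp_all add: add.commute)
    qed
  qed
qed

section \<open>Pairs of reduced monomials and the integer points they represent\<close>

context harmony_pair
begin

text \<open>Membership depends only on the supports, see \<open>joint_faces_mono\<close>: these are
  the monomials supported on the faces of a simplicial complex.\<close>

definition faces :: "(('n \<Rightarrow> nat) \<times> ('m \<Rightarrow> nat)) set"
  where "faces = {(u, v). FA.reduced u \<and> FB.reduced v \<and> (\<forall>k. weight A u $ k = 0 \<or> weight B v $ k = 0)}"

definition point :: "('n \<Rightarrow> nat) \<times> ('m \<Rightarrow> nat) \<Rightarrow> int ^ 'd"
  where "point t = weight A (fst t) - weight B (snd t)"

lemma weight_nonneg: "weight A u $ k \<ge> 0" "weight B v $ k \<ge> 0"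
  using harmony_nonneg[OF harmony] by (auto simp: weight_def intro!: sum_nonneg)

text \<open>Two nonnegative vectors with disjoint supports are the positive and the negative part of
  their difference, so \<open>point t\<close> determines both weights, and
  \<open>reduced_unique\<close> recovers the monomials.\<close>

lemma inj_on_point: "inj_on point faces"
proof
  fix t t' assume t: "t \<in> faces" "t' \<in> faces" "point t = point t'"
  have *: "weight A (fst t) = pos_part_vec (point t)" "weight B (snd t) = neg_part_vec (point t)"
    if "t \<in> faces" for t
  proof -
    have "weight A (fst t) $ k = max 0 (weight A (fst t) $ k - weight B (snd t) $ k) \<and>
       weight B (snd t) $ k = max 0 (- (weight A (fst t) $ k - weight B (snd t) $ k))" for k
    proof -
      have "weight A (fst t) $ k = 0 \<or> weight B (snd t) $ k = 0"
        using that by (simp add: faces_def case_prod_beta)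
      then show ?thesis
        using weight_nonneg(1)[of "fst t" k] weight_nonneg(2)[of "snd t" k] by linarith
    qed
    then show "weight A (fst t) = pos_part_vec (point t)" "weight B (snd t) = neg_part_vec (point t)"
      by (simp_all add: pos_part_vec_def neg_part_vec_def point_def vec_eq_iff)
  qed
  have "weight A (fst t) = weight A (fst t')" "weight B (snd t) = weight B (snd t')"
    using *[OF t(1)] *[OF t(2)] t(3) by simp_all
  then have "fst t = fst t'" "snd t = snd t'"
    using t(1,2) by (simp_all add: faces_def case_prod_beta FA.reduced_unique FB.reduced_unique)
  then show "t = t'" by (rule prod_eqI)
qed

text \<open>\<open>harmony_decomposition\<close> splits \<open>z\<close> into its two parts without
  changing the coefficient sums; \<open>cone_point_A\<close>, for either matrix, then represents
  each part by a reduced monomial whose degree is at most the corresponding sum.\<close>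

lemma face_exists:
  assumes "\<And>i. \<alpha> i \<ge> (0 :: real)" "\<And>j. \<beta> j \<ge> (0 :: real)"
    and z: "\<And>k. real_of_int (z $ k) = cone_map A \<alpha> k - cone_map B \<beta> k"
  shows "\<exists>u v. (u, v) \<in> faces \<and> point (u, v) = z \<and>
    real (total_degree u) \<le> sum \<alpha> UNIV \<and> real (total_degree v) \<le> sum \<beta> UNIV"
proof -
  interpret S: harmony_pair B q stdB A p stdA by (rule harmony_pair_sym[OF harmony_pair_axioms])
  obtain \<alpha>' \<beta>' where ab: "\<And>i. \<alpha>' i \<ge> 0" "\<And>j. \<beta>' j \<ge> 0" "sum \<alpha>' UNIV = sum \<alpha> UNIV"
    "sum \<beta>' UNIV = sum \<beta> UNIV" "\<And>k. cone_map A \<alpha>' k = max 0 (real_of_int (z $ k))"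
    "\<And>k. cone_map B \<beta>' k = max 0 (- real_of_int (z $ k))"
    using harmony_decomposition[OF harmony, of \<alpha> \<beta> "\<lambda>k. real_of_int (z $ k)"] assms by blast
  have of_int_max: "real_of_int (max 0 y) = max 0 (real_of_int y)" for y
    by (simp add: max_def)
  obtain u where u: "FA.reduced u" "weight A u = pos_part_vec z" "real (total_degree u) \<le> sum \<alpha>' UNIV"
    using cone_point_A[of \<alpha>' "pos_part_vec z"] ab by (auto simp: pos_part_vec_def of_int_max)
  obtain v where v: "FB.reduced v" "weight B v = neg_part_vec z" "real (total_degree v) \<le> sum \<beta>' UNIV"
    using S.cone_point_A[of \<beta>' "neg_part_vec z"] ab by (auto simp: neg_part_vec_def of_int_max)
  have "(u, v) \<in> faces"
    using u v by (auto simp: faces_def pos_part_vec_def neg_part_vec_def)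
  moreover have "point (u, v) = z"
    by (auto simp: point_def u v pos_part_vec_def neg_part_vec_def vec_eq_iff)
  ultimately show ?thesis using u(3) v(3) unfolding ab(3,4) by (intro exI conjI)
qed

end

section \<open>Counting monomials\<close>

definition hilbert_series :: "('a::finite \<Rightarrow> nat) set \<Rightarrow> real fps"
  where "hilbert_series S = Abs_fps (\<lambda>n. real (card {u\<in>S. total_degree u = n}))"

lemma finite_total_degree_eq: "finite {u \<in> S. total_degree (u :: 'a::finite \<Rightarrow> nat) = n}"
  by (rule finite_subset[OF _ finite_total_degree_le[of n]]) auto

lemma total_degree_0_iff: "total_degree u = 0 \<longleftrightarrow> u = (\<lambda>_. 0)"
  by (auto simp: total_degree_def)

lemma hilbert_series_support_empty: "hilbert_series {u. support u = {}} = 1"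
proof (rule fps_ext)
  fix n
  have "{u \<in> {u. support u = {}}. total_degree u = n} = (if n = 0 then {\<lambda>_ :: 'a::finite. 0} else {})"
    by (auto simp: support_def total_degree_def)
  then show "fps_nth (hilbert_series {u :: 'a \<Rightarrow> nat. support u = {}}) n = fps_nth 1 n"
    by (auto simp: hilbert_series_def)
qed

text \<open>Raising the exponent of \<open>i\<close> by one maps the monomials of degree
  \<open>n\<close> with support \<open>F\<close> or \<open>insert i F\<close> bijectively onto those
  of degree \<open>n + 1\<close> with support \<open>insert i F\<close>.\<close>

lemma hilbert_series_support_insert:
  assumes i: "i \<notin> F"
  shows "(1 - fps_X) * hilbert_series {u. support u = insert i F} = fps_X * hilbert_series {u. support u = F}"
proof -
  let ?c = "\<lambda>F n. card {u\<in>{u. support u = F}. total_degree u = n}"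
  have step: "?c (insert i F) (Suc n) = ?c (insert i F) n + ?c F n" for n
  proof -
    let ?A = "{u\<in>{u. support u = insert i F}. total_degree u = n}"
    let ?B = "{u\<in>{u. support u = F}. total_degree u = n}"
    let ?C = "{u\<in>{u. support u = insert i F}. total_degree u = Suc n}"
    let ?f = "\<lambda>u. u(i := Suc (u i))"
    have deg: "total_degree (?f u) = Suc (total_degree u)" for u
      unfolding total_degree_def by (simp add: sum.remove[of UNIV i])
    have "bij_betw ?f (?A \<union> ?B) ?C"
    proof (rule bij_betwI[where g = "\<lambda>u. u(i := u i - 1)"])
      show "?f \<in> ?A \<union> ?B \<rightarrow> ?C"
        using deg i by (auto simp: support_def set_eq_iff)
      show "(\<lambda>u. u(i := u i - 1)) \<in> ?C \<rightarrow> ?A \<union> ?B"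
      proof
        fix u assume u: "u \<in> ?C"
        let ?u = "u(i := u i - 1)"
        have ui: "u i \<noteq> 0" using u by (auto simp: support_def set_eq_iff)
        have "?f ?u = u" using ui by auto
        then have "total_degree ?u = n" using deg[of ?u] u by simp
        moreover have "support ?u = insert i F \<or> support ?u = F"
        proof (cases "u i = 1")
          case True then show ?thesis using u i by (auto simp: support_def set_eq_iff)
        next
          case False then show ?thesis using u i ui by (auto simp: support_def set_eq_iff)
        qed
        ultimately show "?u \<in> ?A \<union> ?B" by auto
      qed
      show "(?f u)(i := ?f u i - 1) = u" for u by simp
      show "?f (u(i := u i - 1)) = u" if "u \<in> ?C" for u
      proof -
        have "u i \<noteq> 0" using that by (auto simp: support_def set_eq_iff)
        then show ?thesis by auto
      qed
    qed
    then have "card ?C = card (?A \<union> ?B)" by (simp add: bij_betw_same_card)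
    also have "\<dots> = card ?A + card ?B"
      using i by (intro card_Un_disjoint finite_total_degree_eq) auto
    finally show ?thesis .
  qed
  have zero: "?c (insert i F) 0 = 0"
  proof -
    have "{u\<in>{u. support u = insert i F}. total_degree u = 0} = {}"
      by (auto simp: total_degree_0_iff support_def)
    then show ?thesis by (simp only: card.empty)
  qed
  show ?thesis
  proof (rule fps_ext)
    fix n
    show "fps_nth ((1 - fps_X) * hilbert_series {u. support u = insert i F}) n =
        fps_nth (fps_X * hilbert_series {u. support u = F}) n"
      by (cases n) (simp_all only: left_diff_distrib fps_sub_nth mult_1 fps_X_mult_nth hilbert_series_def
          fps_nth_Abs_fps step zero, simp_all)
  qed
qed

text \<open>Each variable of the support contributes a factor \<open>X / (1 - X)\<close>, written
  here without division.\<close>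

lemma hilbert_series_support:
  fixes F :: "'a::finite set"
  shows "(1 - fps_X) ^ card F * hilbert_series {u. support u = F} = fps_X ^ card F"
proof (induction F rule: finite_induct[OF finite])
  case 1
  show ?case by (simp add: hilbert_series_support_empty)
next
  case (2 i F)
  have "(1 - fps_X) ^ card (insert i F) * hilbert_series {u. support u = insert i F} =
      (1 - fps_X) ^ card F * ((1 - fps_X) * hilbert_series {u. support u = insert i F})"
    using 2 by (simp add: algebra_simps)
  also have "\<dots> = fps_X * ((1 - fps_X) ^ card F * hilbert_series {u. support u = F})"
    unfolding hilbert_series_support_insert[OF 2(2)] by (simp add: algebra_simps)
  also have "\<dots> = fps_X ^ card (insert i F)"
    using 2 by simp
  finally show ?case .
qed

text \<open>The set splits into finitely many classes by support, and \<open>(1 - X)^D\<close>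
  clears the denominator of each class.\<close>

lemma hilbert_series_polynomial:
  fixes S :: "('a::finite \<Rightarrow> nat) set"
  assumes closed: "\<And>u v. u \<in> S \<Longrightarrow> support v = support u \<Longrightarrow> v \<in> S"
    and small: "\<And>u. u \<in> S \<Longrightarrow> card (support u) \<le> D"
  shows "\<exists>q. (1 - fps_X) ^ D * hilbert_series S = fps_of_poly q"
proof -
  let ?\<F> = "support ` S"
  have "hilbert_series S = (\<Sum>F\<in>?\<F>. hilbert_series {u. support u = F})"
  proof (rule fps_ext)
    fix n
    have "{u\<in>S. total_degree u = n} = (\<Union>F\<in>?\<F>. {u\<in>{u. support u = F}. total_degree u = n})"
      using closed by auto
    also have "card \<dots> = (\<Sum>F\<in>?\<F>. card {u\<in>{u. support u = F}. total_degree u = n})"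
      by (intro card_UN_disjoint ballI finite_total_degree_eq impI) auto
    finally show "fps_nth (hilbert_series S) n = fps_nth (\<Sum>F\<in>?\<F>. hilbert_series {u. support u = F}) n"
      by (simp add: hilbert_series_def fps_sum_nth)
  qed
  then have "(1 - fps_X) ^ D * hilbert_series S =
      (\<Sum>F\<in>?\<F>. (1 - fps_X) ^ D * hilbert_series {u. support u = F})"
    by (simp add: sum_distrib_left)
  also have "\<dots> = (\<Sum>F\<in>?\<F>. fps_of_poly ([:1, -1:] ^ (D - card F) * monom 1 (card F)))"
  proof (rule sum.cong)
    fix F assume "F \<in> ?\<F>"
    then have "card F \<le> D" using small by auto
    then have "(1 - fps_X) ^ D * hilbert_series {u. support u = F} =
        (1 - fps_X) ^ (D - card F) * ((1 - fps_X) ^ card F * hilbert_series {u. support u = F})"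
      by (simp flip: power_add mult.assoc)
    also have "\<dots> = fps_of_poly ([:1, -1:] ^ (D - card F) * monom 1 (card F))"
      unfolding hilbert_series_support
      by (simp add: fps_of_poly_mult fps_of_poly_power fps_of_poly_monom fps_of_poly_pCons)
    finally show "(1 - fps_X) ^ D * hilbert_series {u. support u = F} =
        fps_of_poly ([:1, -1:] ^ (D - card F) * monom 1 (card F))" .
  qed simp
  also have "\<dots> = fps_of_poly (\<Sum>F\<in>?\<F>. [:1, -1:] ^ (D - card F) * monom 1 (card F))"
    by (simp add: fps_of_poly_sum)
  finally show ?thesis by (rule exI)
qed

lemma card_box_vec: "card {z :: int ^ 'd::finite. \<forall>k. \<bar>z $ k\<bar> \<le> int b} = (2 * b + 1) ^ CARD('d)"
  and finite_box_vec: "finite {z :: int ^ 'd::finite. \<forall>k. \<bar>z $ k\<bar> \<le> int b}"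
proof -
  let ?P = "PiE (UNIV :: 'd set) (\<lambda>_. {- int b..int b})"
  have eq: "{z :: int ^ 'd. \<forall>k. \<bar>z $ k\<bar> \<le> int b} = vec_lambda ` ?P"
  proof (intro set_eqI iffI)
    fix z :: "int ^ 'd" assume "z \<in> {z. \<forall>k. \<bar>z $ k\<bar> \<le> int b}"
    then show "z \<in> vec_lambda ` ?P"
      by (intro image_eqI[of _ _ "vec_nth z"]) (auto simp: abs_le_iff minus_le_iff)
  qed (auto simp: abs_le_iff PiE_def Pi_def minus_le_iff)
  have inj: "inj_on vec_lambda ?P" by (auto simp: inj_on_def vec_lambda_inject)
  have "card ?P = (2 * b + 1) ^ CARD('d)"
    by (simp add: card_PiE nat_add_distrib nat_mult_distrib)
  then show "card {z :: int ^ 'd. \<forall>k. \<bar>z $ k\<bar> \<le> int b} = (2 * b + 1) ^ CARD('d)"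
    unfolding eq card_image[OF inj] .
  show "finite {z :: int ^ 'd::finite. \<forall>k. \<bar>z $ k\<bar> \<le> int b}"
    unfolding eq by (intro finite_imageI finite_PiE) auto
qed

text \<open>
  The monomials on \<open>F\<close> with exponents at most \<open>b\<close> number \<open>(b + 1)\<^sup>|\<^sup>F\<^sup>|\<close> and are mapped into a box
  with \<open>O(b\<^sup>d)\<close> integer points.
\<close>

lemma card_le_of_inj_on_weight:
  fixes C :: "int ^ 'a::finite ^ 'd::finite"
  assumes inj: "inj_on (weight C) {u. support u \<subseteq> F}"
  shows "card F \<le> CARD('d)"
proof (rule ccontr)
  assume "\<not> ?thesis"
  then have large: "Suc CARD('d) \<le> card F" by simp
  define M where "M = nat (\<Sum>k\<in>UNIV. \<Sum>j\<in>UNIV. \<bar>C $ k $ j\<bar>)"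
  have M: "int M = (\<Sum>k\<in>UNIV. \<Sum>j\<in>UNIV. \<bar>C $ k $ j\<bar>)"
    unfolding M_def by (intro nat_0_le sum_nonneg) auto
  \<comment> \<open>With this \<open>b\<close> the box has at most
    \<open>((2 M + 1) (b + 1))^d = b (b + 1)^d\<close> points, fewer than the
    \<open>(b + 1)^(d + 1)\<close> monomials that exist at least if \<open>F\<close> has more than
    \<open>d\<close> elements.\<close>
  define b where "b = (2 * M + 1) ^ CARD('d)"
  let ?P = "PiE F (\<lambda>_. {..b})"
  let ?ext = "\<lambda>f j. if j \<in> F then f j else (0::nat)"
  have "inj_on (\<lambda>f. weight C (?ext f)) ?P"
  proof (rule inj_onI)
    fix f g assume fg: "f \<in> ?P" "g \<in> ?P" "weight C (?ext f) = weight C (?ext g)"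
    have "?ext f = ?ext g"
      using fg(3) by (rule inj_onD[OF inj]) (auto simp: support_def)
    then have "f j = g j" if "j \<in> F" for j using that by (metis (mono_tags, lifting))
    then show "f = g" using fg(1,2) by (intro PiE_ext[of f F _ g]) auto
  qed
  moreover have "(\<lambda>f. weight C (?ext f)) ` ?P \<subseteq> {z. \<forall>k. \<bar>z $ k\<bar> \<le> int (M * b)}"
  proof safe
    fix f k assume f: "f \<in> ?P"
    have "\<bar>weight C (?ext f) $ k\<bar> \<le> (\<Sum>j\<in>UNIV. \<bar>C $ k $ j\<bar> * int b)"
      unfolding weight_def vec_lambda_beta
      by (rule order_trans[OF sum_abs], rule sum_mono) (use f in \<open>auto simp: abs_mult PiE_def Pi_def intro!: mult_left_mono\<close>)
    also have "\<dots> = (\<Sum>j\<in>UNIV. \<bar>C $ k $ j\<bar>) * int b" by (simp only: sum_distrib_right)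
    also have "\<dots> \<le> int M * int b"
      unfolding M by (intro mult_right_mono member_le_sum[of k UNIV "\<lambda>k. \<Sum>j\<in>UNIV. \<bar>C $ k $ j\<bar>"]) (auto intro: sum_nonneg)
    finally show "\<bar>weight C (?ext f) $ k\<bar> \<le> int (M * b)" by simp
  qed
  ultimately have "card ?P \<le> card {z :: int ^ 'd. \<forall>k. \<bar>z $ k\<bar> \<le> int (M * b)}"
    using finite_box_vec by (rule card_inj_on_le)
  then have "(b + 1) ^ card F \<le> (2 * (M * b) + 1) ^ CARD('d)"
    unfolding card_box_vec by (simp add: card_PiE)
  also have "\<dots> \<le> ((2 * M + 1) * (b + 1)) ^ CARD('d)"
    by (intro power_mono) (auto simp: algebra_simps)
  also have "\<dots> = b * (b + 1) ^ CARD('d)" by (simp only: power_mult_distrib b_def)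
  also have "\<dots> < (b + 1) ^ Suc CARD('d)" by simp
  also have "\<dots> \<le> (b + 1) ^ card F" using large by (intro power_increasing) auto
  finally show False by simp
qed

text \<open>With \<open>f\<close> a polynomial, evaluation at 1 is multiplicative, and the factor
  \<open>1 + X\<close> has the value 2.\<close>

lemma eval_one_doubling:
  assumes "f = fps_of_poly (q :: real poly)"
  shows "eval_fps ((1 + fps_X) * f) 1 = 2 * eval_fps f 1"
proof -
  have "(1 + fps_X) * f = fps_of_poly ([:1, 1:] * q)"
    unfolding assms by (simp add: fps_of_poly_mult fps_of_poly_pCons)
  then have "eval_fps ((1 + fps_X) * f) 1 = poly ([:1, 1:] * q) 1"
    by (simp only: eval_fps_of_poly)
  also have "\<dots> = 2 * poly q 1" by (simp only: poly_mult) simp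
  finally show ?thesis by (simp add: assms)
qed

lemma weight_eq_0_mono:
  assumes C: "nonneg_matrix C" and sub: "support u' \<subseteq> support u" and "weight C u $ k = 0"
  shows "weight C u' $ k = 0"
proof -
  have "(\<Sum>j\<in>UNIV. C $ k $ j * int (u j)) = 0"
    using assms(3) by (simp add: weight_def)
  then have zero: "C $ k $ j * int (u j) = 0" for j
    using C by (subst (asm) sum_nonneg_eq_0_iff) (auto simp: nonneg_matrix_def)
  have "C $ k $ j * int (u' j) = 0" for j
    using zero[of j] sub by (cases "u' j = 0") (auto simp: support_def)
  then show ?thesis unfolding weight_def vec_lambda_beta by (intro sum.neutral ballI)
qed

section \<open>The counting functions of the two polytopes\<close>

context harmony_pair
begin

text \<open>The block matrix \<open>[A, -B]\<close>. A pair of monomials becomes one monomial in the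
  disjoint union of the variables, to which the counting results for a single exponent function
  apply.\<close>

definition joint_matrix :: "int ^ ('n + 'm) ^ 'd"
  where "joint_matrix = (\<chi> k. \<chi> j. case j of Inl i \<Rightarrow> A $ k $ i | Inr i \<Rightarrow> - B $ k $ i)"

definition joint_faces :: "('n + 'm \<Rightarrow> nat) set"
  where "joint_faces = {w. (w \<circ> Inl, w \<circ> Inr) \<in> faces}"

lemma sum_joint: "(\<Sum>j\<in>(UNIV :: ('n + 'm) set). f j) = (\<Sum>i\<in>UNIV. f (Inl i)) + (\<Sum>i\<in>UNIV. f (Inr i))"
  by (subst UNIV_Plus_UNIV[symmetric], subst sum.Plus) (simp_all add: o_def)

lemma weight_joint: "weight joint_matrix w = point (w \<circ> Inl, w \<circ> Inr)"
  by (simp add: weight_def point_def joint_matrix_def sum_joint vec_eq_iff sum_negf)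

lemma total_degree_joint: "total_degree (w :: 'n + 'm \<Rightarrow> nat) = total_degree (w \<circ> Inl) + total_degree (w \<circ> Inr)"
  by (simp add: total_degree_def sum_joint)

lemma joint_faces_mono:
  assumes "w \<in> joint_faces" "support w' \<subseteq> support w"
  shows "w' \<in> joint_faces"
proof -
  have sub: "support (w' \<circ> Inl) \<subseteq> support (w \<circ> Inl)" "support (w' \<circ> Inr) \<subseteq> support (w \<circ> Inr)"
    using assms(2) by (auto simp: support_def)
  have nonneg: "nonneg_matrix A" "nonneg_matrix B" using harmony by (simp_all add: of_harmony_def)
  from assms(1) have red: "FA.reduced (w \<circ> Inl)" "FB.reduced (w \<circ> Inr)"
    and disj: "\<And>k. weight A (w \<circ> Inl) $ k = 0 \<or> weight B (w \<circ> Inr) $ k = 0"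
    by (auto simp: joint_faces_def faces_def)
  have "weight A (w' \<circ> Inl) $ k = 0 \<or> weight B (w' \<circ> Inr) $ k = 0" for k
    using disj[of k] weight_eq_0_mono[OF nonneg(1) sub(1), of k] weight_eq_0_mono[OF nonneg(2) sub(2), of k]
    by (elim disjE) simp_all
  then show ?thesis
    using FA.reduced_mono[OF red(1) sub(1)] FB.reduced_mono[OF red(2) sub(2)]
    by (simp add: joint_faces_def faces_def)
qed

text \<open>Every monomial on the support of \<open>w\<close> belongs again to
  \<open>joint_faces\<close>, where \<open>point\<close> is injective;
  \<open>card_le_of_inj_on_weight\<close> then bounds the support.\<close>

lemma card_support_joint_faces:
  assumes "w \<in> joint_faces"
  shows "card (support w) \<le> CARD('d)"
proof (rule card_le_of_inj_on_weight[of joint_matrix])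
  show "inj_on (weight joint_matrix) {u. support u \<subseteq> support w}"
  proof (rule inj_onI)
    fix u v assume uv: "u \<in> {u. support u \<subseteq> support w}" "v \<in> {u. support u \<subseteq> support w}"
      "weight joint_matrix u = weight joint_matrix v"
    then have "u \<in> joint_faces" "v \<in> joint_faces"
      using joint_faces_mono[OF assms] by auto
    then have "(u \<circ> Inl, u \<circ> Inr) = (v \<circ> Inl, v \<circ> Inr)"
      using uv(3) by (intro inj_onD[OF inj_on_point]) (auto simp: weight_joint joint_faces_def)
    then have "u (Inl i) = v (Inl i)" "u (Inr j) = v (Inr j)" for i j
      by (auto dest: fun_cong)
    then have "u s = v s" for s by (cases s) auto
    then show "u = v" by (rule ext)
  qed
qed

lemma hilbert_series_joint_faces_polynomial:
  "\<exists>q. (1 - fps_X) ^ CARD('d) * hilbert_series joint_faces = fps_of_poly q"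
  by (rule hilbert_series_polynomial) (auto intro: joint_faces_mono card_support_joint_faces)

definition gamma_count :: "nat \<Rightarrow> nat"
  where "gamma_count n = card {(u, v) \<in> faces. total_degree u + total_degree v \<le> n}"

text \<open>Over a pair \<open>(u, v)\<close>, the heights \<open>h\<close> are those with
  \<open>|u| \<le> (n + h) / 2\<close> and \<open>|v| \<le> (n - h) / 2\<close>, the two bounds
  being the coefficient sums on the \<open>A\<close> and on the \<open>B\<close> side.\<close>

definition omega_count :: "nat \<Rightarrow> nat"
  where "omega_count n = card (SIGMA t:{(u, v) \<in> faces. total_degree u + total_degree v \<le> n}.
    {2 * int (total_degree (fst t)) - int n..int n - 2 * int (total_degree (snd t))})"

lemma gamma_count_eq: "gamma_count n = card {w\<in>joint_faces. total_degree w \<le> n}"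
proof -
  have "bij_betw (\<lambda>w. (w \<circ> Inl, w \<circ> Inr)) {w\<in>joint_faces. total_degree w \<le> n}
      {(u, v) \<in> faces. total_degree u + total_degree v \<le> n}"
    by (rule bij_betwI[where g = "\<lambda>(u, v). case_sum u v"])
      (auto simp: joint_faces_def total_degree_joint fun_eq_iff o_def split: sum.split)
  then show ?thesis unfolding gamma_count_def by (simp add: bij_betw_same_card)
qed

lemma finite_faces_le: "finite {(u, v) \<in> faces. total_degree u + total_degree v \<le> n}"
  by (rule finite_subset[OF _ finite_cartesian_product[OF finite_total_degree_le[of n] finite_total_degree_le[of n]]])
    auto

text \<open>Agrees with the constant term 1 that \<open>delta\<close> prescribes, so the counts need
  no exception at \<open>n = 0\<close>.\<close>

lemma gamma_count_0: "gamma_count 0 = 1"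
proof -
  obtain u where "FA.reduced u" "total_degree u \<le> 0"
    using FA.reduced_exists[of "\<lambda>_. 0"] by (auto simp: total_degree_def)
  moreover obtain v where "FB.reduced v" "total_degree v \<le> 0"
    using FB.reduced_exists[of "\<lambda>_. 0"] by (auto simp: total_degree_def)
  ultimately have red: "FA.reduced (\<lambda>_. 0)" "FB.reduced (\<lambda>_. 0)" by (simp_all add: total_degree_0_iff)
  have "{(u, v) \<in> faces. total_degree u + total_degree v \<le> 0} = {(\<lambda>_. 0, \<lambda>_. 0)}"
    using red by (auto simp: total_degree_0_iff faces_def)
  then show ?thesis by (simp add: gamma_count_def)
qed

text \<open>Multiplying by \<open>1 - X\<close> takes differences: from degree at most
  \<open>n\<close> to degree exactly \<open>n\<close>.\<close>

lemma gamma_series: "(1 - fps_X) * Abs_fps (\<lambda>n. real (gamma_count n)) = hilbert_series joint_faces"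
proof (rule fps_ext)
  fix n
  show "fps_nth ((1 - fps_X) * Abs_fps (\<lambda>n. real (gamma_count n))) n = fps_nth (hilbert_series joint_faces) n"
  proof (cases n)
    case 0
    then show ?thesis
      by (simp add: left_diff_distrib hilbert_series_def gamma_count_eq)
  next
    case (Suc m)
    have "card {w\<in>joint_faces. total_degree w \<le> Suc m} =
        card ({w\<in>joint_faces. total_degree w \<le> m} \<union> {w\<in>joint_faces. total_degree w = Suc m})"
      by (rule arg_cong[of _ _ card]) auto
    also have "\<dots> = card {w\<in>joint_faces. total_degree w \<le> m} + card {w\<in>joint_faces. total_degree w = Suc m}"
      by (rule card_Un_disjoint)
        (auto intro: finite_total_degree_eq finite_subset[OF _ finite_total_degree_le[of m]])
    finally have "gamma_count (Suc m) = gamma_count m + card {w\<in>joint_faces. total_degree w = Suc m}"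
      by (simp only: gamma_count_eq)
    then show ?thesis
      using Suc by (simp add: left_diff_distrib hilbert_series_def)
  qed
qed

lemma omega_count_eq:
  "int (omega_count n) =
    (\<Sum>(u, v)\<in>{(u, v) \<in> faces. total_degree u + total_degree v \<le> n}.
      2 * (int n - int (total_degree u) - int (total_degree v)) + 1)"
proof -
  have "omega_count n = (\<Sum>t\<in>{(u, v) \<in> faces. total_degree u + total_degree v \<le> n}.
      card {2 * int (total_degree (fst t)) - int n..int n - 2 * int (total_degree (snd t))})"
    unfolding omega_count_def by (rule card_SigmaI[OF finite_faces_le]) simp
  then have "int (omega_count n) = (\<Sum>t\<in>{(u, v) \<in> faces. total_degree u + total_degree v \<le> n}.
      int (card {2 * int (total_degree (fst t)) - int n..int n - 2 * int (total_degree (snd t))}))"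
    by (simp only: of_nat_sum)
  also have "\<dots> = (\<Sum>(u, v)\<in>{(u, v) \<in> faces. total_degree u + total_degree v \<le> n}.
      2 * (int n - int (total_degree u) - int (total_degree v)) + 1)"
    by (rule sum.cong) auto
  finally show ?thesis .
qed

text \<open>From \<open>n\<close> to \<open>n + 1\<close> the interval over each old pair gains two
  heights, and each new pair, of degree exactly \<open>n + 1\<close>, brings a single one.\<close>

lemma omega_count_Suc: "omega_count (Suc n) = omega_count n + gamma_count n + gamma_count (Suc n)"
proof -
  let ?S = "\<lambda>n. {(u, v) \<in> faces. total_degree u + total_degree v \<le> n}"
  let ?f = "\<lambda>n (u, v). 2 * (int n - int (total_degree u) - int (total_degree v)) + 1"
  have sub: "?S n \<subseteq> ?S (Suc n)" by auto
  have "int (omega_count (Suc n)) = (\<Sum>t\<in>?S (Suc n) - ?S n. ?f (Suc n) t) + (\<Sum>t\<in>?S n. ?f (Suc n) t)"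
    unfolding omega_count_eq by (rule sum.subset_diff[OF sub finite_faces_le])
  also have "(\<Sum>t\<in>?S (Suc n) - ?S n. ?f (Suc n) t) = (\<Sum>t\<in>?S (Suc n) - ?S n. 1)"
    by (rule sum.cong) auto
  also have "\<dots> = int (gamma_count (Suc n)) - int (gamma_count n)"
    using card_Diff_subset[OF finite_faces_le sub] card_mono[OF finite_faces_le sub]
    by (simp add: gamma_count_def of_nat_diff)
  also have "(\<Sum>t\<in>?S n. ?f (Suc n) t) = (\<Sum>t\<in>?S n. ?f n t + 2)"
    by (rule sum.cong) auto
  also have "\<dots> = int (omega_count n) + 2 * int (gamma_count n)"
    unfolding sum.distrib omega_count_eq by (simp add: gamma_count_def)
  finally show ?thesis by linarith
qed

lemma omega_count_0: "omega_count 0 = 1"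
proof -
  have "omega_count 0 = (\<Sum>t\<in>{(u, v) \<in> faces. total_degree u + total_degree v \<le> 0}.
      card {2 * int (total_degree (fst t)) - int 0..int 0 - 2 * int (total_degree (snd t))})"
    unfolding omega_count_def by (rule card_SigmaI[OF finite_faces_le]) simp
  also have "\<dots> = (\<Sum>t\<in>{(u, v) \<in> faces. total_degree u + total_degree v \<le> 0}. 1)"
    by (rule sum.cong) auto
  also have "\<dots> = 1" using gamma_count_0 by (simp add: gamma_count_def)
  finally show ?thesis .
qed

lemma omega_series:
  "(1 - fps_X) * Abs_fps (\<lambda>n. real (omega_count n)) = (1 + fps_X) * Abs_fps (\<lambda>n. real (gamma_count n))"
proof (rule fps_ext)
  fix n
  show "fps_nth ((1 - fps_X) * Abs_fps (\<lambda>n. real (omega_count n))) n =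
      fps_nth ((1 + fps_X) * Abs_fps (\<lambda>n. real (gamma_count n))) n"
    by (cases n) (simp_all add: left_diff_distrib distrib_right omega_count_0 gamma_count_0 omega_count_Suc)
qed

end

section \<open>Integer points of the polytopes\<close>

text \<open>Indexing by \<open>s\<close> lets coefficients be attached to columns even if some
  columns coincide.\<close>

lemma convex_hull_range:
  fixes y :: "'s::finite \<Rightarrow> 'b::real_vector"
  shows "convex hull (range y) = {\<Sum>s\<in>UNIV. c s *\<^sub>R y s | c. (\<forall>s. 0 \<le> c s) \<and> sum c UNIV = (1::real)}"
    (is "_ = ?K")
proof
  show "convex hull (range y) \<subseteq> ?K"
  proof (rule hull_minimal)
    show "range y \<subseteq> ?K"
    proof safe
      fix s
      have "y s = (\<Sum>t\<in>UNIV. (if t = s then 1 else 0) *\<^sub>R y t)"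
        by (simp add: if_distrib[of "\<lambda>c. c *\<^sub>R _"] cong: if_cong)
      then show "\<exists>c. y s = (\<Sum>s\<in>UNIV. c s *\<^sub>R y s) \<and> (\<forall>s. 0 \<le> c s) \<and> sum c UNIV = (1::real)"
        by (intro exI[of _ "\<lambda>t. if t = s then 1 else 0"]) simp
    qed
    show "convex ?K"
    proof (rule convexI)
      fix x x' and a b :: real
      assume "x \<in> ?K" "x' \<in> ?K" and ab: "0 \<le> a" "0 \<le> b" "a + b = 1"
      then obtain c c' where c: "x = (\<Sum>s\<in>UNIV. c s *\<^sub>R y s)" "\<forall>s. 0 \<le> c s" "sum c UNIV = 1"
        and c': "x' = (\<Sum>s\<in>UNIV. c' s *\<^sub>R y s)" "\<forall>s. 0 \<le> c' s" "sum c' UNIV = 1"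
        by auto
      have "a *\<^sub>R x + b *\<^sub>R x' = (\<Sum>s\<in>UNIV. (a * c s + b * c' s) *\<^sub>R y s)"
        by (simp add: c c' scaleR_sum_right scaleR_add_left sum.distrib)
      moreover have "(\<Sum>s\<in>UNIV. a * c s + b * c' s) = 1"
        using c(3) c'(3) ab by (simp add: sum.distrib flip: sum_distrib_left)
      ultimately show "a *\<^sub>R x + b *\<^sub>R x' \<in> ?K"
        using c(2) c'(2) ab by (intro CollectI exI[of _ "\<lambda>s. a * c s + b * c' s"]) auto
    qed
  qed
  show "?K \<subseteq> convex hull (range y)"
  proof safe
    fix c :: "'s \<Rightarrow> real" assume "\<forall>s. 0 \<le> c s" "sum c UNIV = 1"
    then show "(\<Sum>s\<in>UNIV. c s *\<^sub>R y s) \<in> convex hull (range y)"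
      by (intro convex_sum) (simp_all add: hull_inc convex_convex_hull)
  qed
qed

lemma scaled_convex_hull_range:
  fixes y :: "'s::finite \<Rightarrow> 'b::real_vector"
  assumes "r > 0"
  shows "(\<lambda>x. r *\<^sub>R x) ` (convex hull (range y)) =
    {\<Sum>s\<in>UNIV. c s *\<^sub>R y s | c. (\<forall>s. 0 \<le> c s) \<and> sum c UNIV = (r::real)}" (is "?L = ?R")
proof
  show "?L \<subseteq> ?R"
  proof
    fix x assume "x \<in> ?L"
    then obtain c where c: "\<forall>s. 0 \<le> c s" "sum c UNIV = 1" "x = r *\<^sub>R (\<Sum>s\<in>UNIV. c s *\<^sub>R y s)"
      unfolding convex_hull_range by auto
    then have "x = (\<Sum>s\<in>UNIV. (r * c s) *\<^sub>R y s)" "(\<Sum>s\<in>UNIV. r * c s) = r"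
      by (simp_all add: scaleR_sum_right flip: sum_distrib_left)
    with c(1) assms show "x \<in> ?R" by (intro CollectI exI[of _ "\<lambda>s. r * c s"]) auto
  qed
  show "?R \<subseteq> ?L"
  proof
    fix x assume "x \<in> ?R"
    then obtain c where c: "\<forall>s. 0 \<le> c s" "sum c UNIV = r" "x = (\<Sum>s\<in>UNIV. c s *\<^sub>R y s)" by auto
    then have "x = r *\<^sub>R (\<Sum>s\<in>UNIV. (c s / r) *\<^sub>R y s)" "(\<Sum>s\<in>UNIV. c s / r) = 1"
      using assms by (simp_all add: scaleR_sum_right flip: sum_divide_distrib)
    then show "x \<in> ?L" unfolding convex_hull_range using c(1) assms
      by (intro image_eqI CollectI exI[of _ "\<lambda>s. c s / r"]) auto
  qed
qed

text \<open>A lattice polytope is the hull of some lattice points it contains, so its full set of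
  lattice points has the same hull.\<close>

lemma lattice_polytope_eq_hull:
  assumes "lattice_polytope P" "P \<inter> integer_points = S"
  shows "P = convex hull S"
proof -
  obtain V where V: "V \<subseteq> integer_points" "P = convex hull V"
    using assms(1) by (auto simp: lattice_polytope_def)
  have "V \<subseteq> S" using V assms(2) hull_subset[of V convex] by blast
  moreover have "convex hull S \<subseteq> P"
    using assms(2) V(2) by (intro hull_minimal) (auto simp: convex_convex_hull)
  ultimately show ?thesis using V(2) hull_mono[of V S convex] by blast
qed

lemma convex_hull_uminus: "uminus ` (convex hull S) = convex hull (uminus ` (S :: 'b::real_vector set))"
proof -
  have "linear (uminus :: 'b \<Rightarrow> 'b)" by (rule linear_uminus)
  then show ?thesis by (rule convex_hull_linear_image)
qed

lemma convex_hull_Un_hulls: "convex hull (convex hull S \<union> convex hull T) = convex hull (S \<union> T)"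
  by (rule hull_Un[symmetric]) (simp add: convex_Inter)

lemma Gamma_polytope_hull:
  "Gamma_polytope (convex hull X) (convex hull Y) = convex hull (X \<union> uminus ` Y)"
  unfolding Gamma_polytope_def convex_hull_uminus by (rule convex_hull_Un_hulls)

lemma Omega_polytope_hull:
  "Omega_polytope (convex hull X) (convex hull Y) = convex hull (X \<times> {1} \<union> uminus ` Y \<times> {-1})"
proof -
  have "(convex hull S) \<times> {r} = convex hull (S \<times> {r})" for S :: "(real ^ 'a) set" and r :: real
    by (simp add: convex_hull_Times)
  then show ?thesis
    unfolding Omega_polytope_def convex_hull_uminus by (simp only: convex_hull_Un_hulls)
qed

lemma integer_points_vec: "(integer_points :: (real ^ 'd::finite) set) = range real_vec"
proof
  show "(integer_points :: (real ^ 'd) set) \<subseteq> range real_vec"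
  proof
    fix x :: "real ^ 'd" assume x: "x \<in> integer_points"
    have "x $ k \<in> \<int>" for k
    proof -
      have "axis k 1 \<in> (Basis :: (real ^ 'd) set)" by (simp add: axis_in_Basis_iff)
      then have "x \<bullet> axis k 1 \<in> \<int>" using x by (simp add: integer_points_def)
      then show ?thesis by (simp add: inner_axis)
    qed
    then have "x = real_vec (\<chi> k. \<lfloor>x $ k\<rfloor>)"
      by (simp add: real_vec_def vec_eq_iff)
    then show "x \<in> range real_vec" by (rule range_eqI)
  qed
  show "range real_vec \<subseteq> (integer_points :: (real ^ 'd) set)"
    by (auto simp: integer_points_def real_vec_def Basis_vec_def inner_axis)
qed

lemma integer_points_prod:
  "(integer_points :: ('a::euclidean_space \<times> real) set) = integer_points \<times> \<int>"
  by (auto simp: integer_points_def Basis_prod_def)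

lemma real_vec_add: "real_vec (y + z) = real_vec y + real_vec z"
  and real_vec_scale: "real_vec (c *s z) = of_int c *\<^sub>R real_vec z"
  and real_vec_uminus: "real_vec (- z) = - real_vec z"
  and real_vec_0: "real_vec 0 = 0"
  by (simp_all add: real_vec_def vec_eq_iff)

lemma inj_real_vec: "inj real_vec"
  by (auto simp: inj_def real_vec_def vec_eq_iff)

context standard_family
begin

lemma lattice_scale:
  assumes "z \<in> lattice"
  shows "c *s z \<in> lattice"
proof (cases "c \<ge> 0")
  case True
  then show ?thesis using lattice_scale_nat[OF assms, of "nat c"] by simp
next
  case False
  then have "c *s z = - (int (nat (- c)) *s z)" by (simp add: vec_eq_iff)
  then show ?thesis using lattice_minus[OF lattice_scale_nat[OF assms]] by (simp only:)
qed

end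

text \<open>All integer points of \<open>G\<close> are columns of \<open>A\<close>, negated columns
  of \<open>B\<close> or zero, so integer combinations of them lie in the sum of the two
  lattices.\<close>

lemma lattice_sum_spanning:
  fixes A :: "int ^ 'n::finite ^ 'd::finite" and B :: "int ^ 'm::finite ^ 'd"
  assumes FA: "standard_family A p stdA" and FB: "standard_family B q stdB"
    and span: "(integer_points :: ((real ^ 'd) \<times> real) set)
           \<subseteq> integer_combinations ((G \<times> {1}) \<inter> integer_points)"
    and G: "G \<inter> integer_points \<subseteq>
      real_vec ` range (\<lambda>i. column i A) \<union> (\<lambda>z. - real_vec z) ` range (\<lambda>j. column j B) \<union> {0}"
  shows "\<exists>a\<in>standard_family.lattice A. \<exists>b\<in>standard_family.lattice B. z = a + b"
proof -
  interpret FA: standard_family A p stdA by fact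
  interpret FB: standard_family B q stdB by fact
  define L where "L = {a + b | a b. a \<in> FA.lattice \<and> b \<in> FB.lattice}"
  have L_I: "a + b \<in> L" if "a \<in> FA.lattice" "b \<in> FB.lattice" for a b
    using that by (auto simp: L_def)
  have L_add: "y + y' \<in> L" if y: "y \<in> L" "y' \<in> L" for y y'
  proof -
    obtain a b a' b' where ab: "a \<in> FA.lattice" "b \<in> FB.lattice" "y = a + b"
      "a' \<in> FA.lattice" "b' \<in> FB.lattice" "y' = a' + b'"
      using y by (auto simp: L_def)
    then have "y + y' = (a + a') + (b + b')" by simp
    then show ?thesis using L_I[OF FA.lattice_add[OF ab(1,4)] FB.lattice_add[OF ab(2,5)]] by simp
  qed
  have L_scale: "c *s y \<in> L" if y: "y \<in> L" for c y
  proof -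
    obtain a b where ab: "a \<in> FA.lattice" "b \<in> FB.lattice" "y = a + b"
      using y by (auto simp: L_def)
    then have "c *s y = c *s a + c *s b" by (simp add: vec_eq_iff algebra_simps)
    then show ?thesis using L_I[OF FA.lattice_scale[OF ab(1)] FB.lattice_scale[OF ab(2)]] by simp
  qed
  have L_0: "0 \<in> L" using L_I[OF FA.zero_in_lattice FB.zero_in_lattice] by simp
  have L_G: "x \<in> real_vec ` L" if x: "x \<in> G \<inter> integer_points" for x
  proof -
    have "column i A \<in> L" for i using L_I[OF FA.column_in_lattice FB.zero_in_lattice] by simp
    moreover have "- column j B \<in> L" for j
      using L_I[OF FA.zero_in_lattice FB.lattice_minus[OF FB.column_in_lattice]] by simp
    moreover have "(\<exists>i. x = real_vec (column i A)) \<or> (\<exists>j. x = real_vec (- column j B)) \<or> x = real_vec 0"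
      using subsetD[OF G x] by (auto simp: real_vec_uminus real_vec_0)
    ultimately show ?thesis using L_0 by auto
  qed
  \<comment> \<open>The last coordinate is dropped afterwards, so any integer height would serve; 0
    is taken.\<close>
  have "(real_vec z, 0) \<in> (integer_points :: ((real ^ 'd) \<times> real) set)"
    by (simp add: integer_points_prod integer_points_vec)
  from subsetD[OF span this] obtain F :: "((real ^ 'd) \<times> real) set" and c where F: "finite F" "F \<subseteq> (G \<times> {1}) \<inter> integer_points"
    "(real_vec z, 0) = (\<Sum>x\<in>F. real_of_int (c x) *\<^sub>R x)"
    unfolding integer_combinations_def mem_Collect_eq by (elim exE conjE) (rule that)
  have "(\<Sum>x\<in>F. real_of_int (c x) *\<^sub>R fst x) \<in> real_vec ` L"
    using F(1,2)
  proof (induction F)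
    case empty
    show ?case using L_0 by (auto simp: image_iff real_vec_0 intro!: bexI[of _ 0])
  next
    case (insert x F)
    have "fst x \<in> G \<inter> integer_points" using insert.prems by (auto simp: integer_points_prod)
    then obtain y where y: "y \<in> L" "fst x = real_vec y" using L_G by auto
    obtain y' where y': "y' \<in> L" "(\<Sum>x\<in>F. real_of_int (c x) *\<^sub>R fst x) = real_vec y'"
      using insert by auto
    have "(\<Sum>x\<in>insert x F. real_of_int (c x) *\<^sub>R fst x) = real_vec (c x *s y + y')"
      using insert.hyps y y' by (simp add: real_vec_add real_vec_scale)
    then show ?case using L_add[OF L_scale[OF y(1)] y'(1)] by auto
  qed
  moreover have "real_vec z = (\<Sum>x\<in>F. real_of_int (c x) *\<^sub>R fst x)"
    using arg_cong[OF F(3), of fst] by (simp add: fst_sum)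
  ultimately have "real_vec z \<in> real_vec ` L" by (simp only:)
  then have "z \<in> L" by (simp only: inj_image_mem_iff[OF inj_real_vec])
  then show ?thesis unfolding L_def by auto
qed

lemma columns_eq_range: "columns A = range (\<lambda>i. column i A)"
  by (auto simp: columns_def)

lemma image_Times_singleton: "f ` S \<times> {c} = (\<lambda>x. (f x, c)) ` S"
  by auto

section \<open>Integer points of the dilated polytopes\<close>

context harmony_pair
begin

definition hull_A :: "(real ^ 'd) set"
  where "hull_A = convex hull (real_vec ` columns A)"

definition hull_B :: "(real ^ 'd) set"
  where "hull_B = convex hull (real_vec ` columns B)"

lemma sum_columns:
  "(\<Sum>i\<in>UNIV. \<alpha> i *\<^sub>R real_vec (column i A)) $ k = cone_map A \<alpha> k"
  "(\<Sum>j\<in>UNIV. \<beta> j *\<^sub>R - real_vec (column j B)) $ k = - cone_map B \<beta> k"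
  by (simp_all add: cone_map_def real_vec_def column_def sum_negf mult.commute)

lemma mem_scaled_Gamma:
  assumes "r > 0"
  shows "x \<in> (\<lambda>x. r *\<^sub>R x) ` Gamma_polytope hull_A hull_B \<longleftrightarrow>
    (\<exists>\<alpha> \<beta>. (\<forall>i. 0 \<le> \<alpha> i) \<and> (\<forall>j. 0 \<le> \<beta> j) \<and> sum \<alpha> UNIV + sum \<beta> UNIV = r \<and>
      (\<forall>k. x $ k = cone_map A \<alpha> k - cone_map B \<beta> k))" (is "?L \<longleftrightarrow> ?R")
proof -
  let ?y = "case_sum (\<lambda>i. real_vec (column i A)) (\<lambda>j. - real_vec (column j B))"
  have range: "real_vec ` columns A \<union> uminus ` real_vec ` columns B = range ?y"
    by (simp add: columns_eq_range UNIV_sum image_Un image_image image_Times_singleton)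
  have "?L \<longleftrightarrow> (\<exists>c. x = (\<Sum>s\<in>UNIV. c s *\<^sub>R ?y s) \<and> (\<forall>s. 0 \<le> c s) \<and> sum c UNIV = r)"
    unfolding hull_A_def hull_B_def Gamma_polytope_hull range scaled_convex_hull_range[OF assms] by simp
  also have "\<dots> \<longleftrightarrow> ?R"
  proof
    assume "\<exists>c. x = (\<Sum>s\<in>UNIV. c s *\<^sub>R ?y s) \<and> (\<forall>s. 0 \<le> c s) \<and> sum c UNIV = r"
    then obtain c where c: "x = (\<Sum>s\<in>UNIV. c s *\<^sub>R ?y s)" "\<forall>s. 0 \<le> c s" "sum c UNIV = r" by blast
    then show ?R
      by (intro exI[of _ "\<lambda>i. c (Inl i)"] exI[of _ "\<lambda>i. c (Inr i)"])
        (simp add: sum_joint sum_columns[symmetric])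
  next
    assume ?R
    then obtain \<alpha> \<beta> where "\<forall>i. 0 \<le> \<alpha> i" "\<forall>j. 0 \<le> \<beta> j" "sum \<alpha> UNIV + sum \<beta> UNIV = r"
      "\<forall>k. x $ k = cone_map A \<alpha> k - cone_map B \<beta> k" by blast
    then show "\<exists>c. x = (\<Sum>s\<in>UNIV. c s *\<^sub>R ?y s) \<and> (\<forall>s. 0 \<le> c s) \<and> sum c UNIV = r"
      by (intro exI[of _ "case_sum \<alpha> \<beta>"])
        (simp add: sum_joint vec_eq_iff cone_map_def real_vec_def column_def sum_negf mult.commute split: sum.split)
  qed
  finally show ?thesis .
qed

text \<open>The last coordinate is 1 on the \<open>A\<close> side and -1 on the \<open>B\<close>
  side. Together with the total \<open>r\<close> it fixes both coefficient sums separately, and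
  \<open>face_exists\<close> bounds the degrees by these two sums.\<close>

lemma mem_scaled_Omega:
  assumes "r > 0"
  shows "(x, h) \<in> (\<lambda>x. r *\<^sub>R x) ` Omega_polytope hull_A hull_B \<longleftrightarrow>
    (\<exists>\<alpha> \<beta>. (\<forall>i. 0 \<le> \<alpha> i) \<and> (\<forall>j. 0 \<le> \<beta> j) \<and> sum \<alpha> UNIV + sum \<beta> UNIV = r \<and>
      (\<forall>k. x $ k = cone_map A \<alpha> k - cone_map B \<beta> k) \<and> h = sum \<alpha> UNIV - sum \<beta> UNIV)" (is "?L \<longleftrightarrow> ?R")
proof -
  let ?y = "case_sum (\<lambda>i. (real_vec (column i A), 1 :: real)) (\<lambda>j. (- real_vec (column j B), -1))"
  have range: "real_vec ` columns A \<times> {1} \<union> uminus ` real_vec ` columns B \<times> {-1} = range ?y"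
    by (simp add: columns_eq_range UNIV_sum image_Un image_image image_Times_singleton)
  have comps: "(\<Sum>s\<in>UNIV. c s *\<^sub>R ?y s) =
      ((\<Sum>i\<in>UNIV. c (Inl i) *\<^sub>R real_vec (column i A)) + (\<Sum>j\<in>UNIV. c (Inr j) *\<^sub>R - real_vec (column j B)),
       (\<Sum>i\<in>UNIV. c (Inl i)) - (\<Sum>j\<in>UNIV. c (Inr j)))" for c
    by (simp add: sum_joint prod_eq_iff fst_sum snd_sum sum_negf)
  have "?L \<longleftrightarrow> (\<exists>c. (x, h) = (\<Sum>s\<in>UNIV. c s *\<^sub>R ?y s) \<and> (\<forall>s. 0 \<le> c s) \<and> sum c UNIV = r)"
    unfolding hull_A_def hull_B_def Omega_polytope_hull range scaled_convex_hull_range[OF assms] by simp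
  also have "\<dots> \<longleftrightarrow> ?R"
  proof
    assume "\<exists>c. (x, h) = (\<Sum>s\<in>UNIV. c s *\<^sub>R ?y s) \<and> (\<forall>s. 0 \<le> c s) \<and> sum c UNIV = r"
    then obtain c where c: "(x, h) = (\<Sum>s\<in>UNIV. c s *\<^sub>R ?y s)" "\<forall>s. 0 \<le> c s" "sum c UNIV = r" by blast
    then show ?R unfolding comps
      by (intro exI[of _ "\<lambda>i. c (Inl i)"] exI[of _ "\<lambda>i. c (Inr i)"])
        (simp add: sum_joint sum_columns[symmetric])
  next
    assume ?R
    then obtain \<alpha> \<beta> where "\<forall>i. 0 \<le> \<alpha> i" "\<forall>j. 0 \<le> \<beta> j" "sum \<alpha> UNIV + sum \<beta> UNIV = r"
      "\<forall>k. x $ k = cone_map A \<alpha> k - cone_map B \<beta> k" "h = sum \<alpha> UNIV - sum \<beta> UNIV" by blast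
    then show "\<exists>c. (x, h) = (\<Sum>s\<in>UNIV. c s *\<^sub>R ?y s) \<and> (\<forall>s. 0 \<le> c s) \<and> sum c UNIV = r"
      unfolding comps
      by (intro exI[of _ "case_sum \<alpha> \<beta>"])
        (simp add: sum_joint vec_eq_iff cone_map_def real_vec_def column_def sum_negf mult.commute split: sum.split)
  qed
  finally show ?thesis .
qed

text \<open>The zero columns \<open>p\<close> and \<open>q\<close> absorb the slack between the degrees and the prescribed sums.\<close>

lemma point_representation:
  assumes "real (total_degree u) \<le> a" "real (total_degree v) \<le> b"
  shows "\<exists>\<alpha> \<beta>. (\<forall>i. 0 \<le> \<alpha> i) \<and> (\<forall>j. 0 \<le> \<beta> j) \<and> sum \<alpha> UNIV = a \<and> sum \<beta> UNIV = b \<and>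
    (\<forall>k. real_vec (point (u, v)) $ k = cone_map A \<alpha> k - cone_map B \<beta> k)"
proof -
  define \<alpha> where "\<alpha> = (\<lambda>i. real (u i) + (if i = p then a - real (total_degree u) else 0))"
  define \<beta> where "\<beta> = (\<lambda>j. real (v j) + (if j = q then b - real (total_degree v) else 0))"
  have cone: "cone_map A \<alpha> k = of_int (weight A u $ k)" "cone_map B \<beta> k = of_int (weight B v $ k)" for k
  proof -
    have "of_int (A $ k $ i) * \<alpha> i = of_int (A $ k $ i) * real (u i)" for i
      by (cases "i = p") (simp_all add: \<alpha>_def)
    then show "cone_map A \<alpha> k = of_int (weight A u $ k)"
      by (simp only: cone_map_def) (simp add: weight_def)
    have "of_int (B $ k $ j) * \<beta> j = of_int (B $ k $ j) * real (v j)" for j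
      by (cases "j = q") (simp_all add: \<beta>_def)
    then show "cone_map B \<beta> k = of_int (weight B v $ k)"
      by (simp only: cone_map_def) (simp add: weight_def)
  qed
  have "sum \<alpha> UNIV = a" "sum \<beta> UNIV = b"
    by (simp_all add: \<alpha>_def \<beta>_def sum.distrib total_degree_def)
  moreover have "\<forall>i. 0 \<le> \<alpha> i" "\<forall>j. 0 \<le> \<beta> j" using assms by (simp_all add: \<alpha>_def \<beta>_def)
  moreover have "\<forall>k. real_vec (point (u, v)) $ k = cone_map A \<alpha> k - cone_map B \<beta> k"
    by (simp add: cone real_vec_def point_def)
  ultimately show ?thesis by (intro exI conjI)
qed

text \<open>\<open>point\<close> gives the bijection: \<open>point_representation\<close> places
  \<open>point t\<close> in the dilate, \<open>face_exists\<close> provides the preimage.\<close>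

lemma card_scaled_Gamma:
  assumes n: "n > 0"
  shows "card ((\<lambda>x. real n *\<^sub>R x) ` Gamma_polytope hull_A hull_B \<inter> integer_points) = gamma_count n"
proof -
  let ?S = "{(u, v) \<in> faces. total_degree u + total_degree v \<le> n}"
  let ?T = "(\<lambda>x. real n *\<^sub>R x) ` Gamma_polytope hull_A hull_B \<inter> integer_points"
  have n': "real n > 0" using n by simp
  have image: "(\<lambda>t. real_vec (point t)) ` ?S = ?T"
  proof
    show "(\<lambda>t. real_vec (point t)) ` ?S \<subseteq> ?T"
    proof clarify
      fix u v assume uv: "(u, v) \<in> faces" "total_degree u + total_degree v \<le> n"
      \<comment> \<open>All the slack \<open>n - |u| - |v|\<close> goes to the zero column of
        \<open>B\<close>.\<close>
      then have "real (total_degree v) \<le> real n - real (total_degree u)" by linarith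
      from point_representation[OF order_refl this] obtain \<alpha> \<beta> where
        ab: "\<forall>i. 0 \<le> \<alpha> i" "\<forall>j. 0 \<le> \<beta> j" "sum \<alpha> UNIV = real (total_degree u)"
        "sum \<beta> UNIV = real n - real (total_degree u)"
        "\<forall>k. real_vec (point (u, v)) $ k = cone_map A \<alpha> k - cone_map B \<beta> k" by blast
      then have "real_vec (point (u, v)) \<in> (\<lambda>x. real n *\<^sub>R x) ` Gamma_polytope hull_A hull_B"
        unfolding mem_scaled_Gamma[OF n'] by (intro exI[of _ \<alpha>] exI[of _ \<beta>]) simp
      then show "real_vec (point (u, v)) \<in> ?T" by (simp add: integer_points_vec)
    qed
    show "?T \<subseteq> (\<lambda>t. real_vec (point t)) ` ?S"
    proof
      fix x assume x: "x \<in> ?T"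
      then obtain z where z: "x = real_vec z" by (auto simp: integer_points_vec)
      from x obtain \<alpha> \<beta> where ab: "\<forall>i. 0 \<le> \<alpha> i" "\<forall>j. 0 \<le> \<beta> j" "sum \<alpha> UNIV + sum \<beta> UNIV = real n"
        "\<forall>k. x $ k = cone_map A \<alpha> k - cone_map B \<beta> k"
        unfolding Int_iff mem_scaled_Gamma[OF n'] by blast
      then have "\<And>k. real_of_int (z $ k) = cone_map A \<alpha> k - cone_map B \<beta> k"
        by (simp add: z real_vec_def)
      then obtain u v where uv: "(u, v) \<in> faces" "point (u, v) = z"
        "real (total_degree u) \<le> sum \<alpha> UNIV" "real (total_degree v) \<le> sum \<beta> UNIV"
        using face_exists[of \<alpha> \<beta> z] ab(1,2) by blast
      then have "(u, v) \<in> ?S" using ab(3) by simp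
      then show "x \<in> (\<lambda>t. real_vec (point t)) ` ?S"
        using uv(2) by (intro image_eqI[of _ _ "(u, v)"]) (simp_all add: z)
    qed
  qed
  have inj: "inj_on (\<lambda>t. real_vec (point t)) ?S"
  proof (rule inj_onI)
    fix t t' assume "t \<in> ?S" "t' \<in> ?S" "real_vec (point t) = real_vec (point t')"
    then show "t = t'" by (intro inj_onD[OF inj_on_point]) (auto dest: injD[OF inj_real_vec])
  qed
  show ?thesis using card_image[OF inj] unfolding image gamma_count_def .
qed

lemma card_scaled_Omega:
  assumes n: "n > 0"
  shows "card ((\<lambda>x. real n *\<^sub>R x) ` Omega_polytope hull_A hull_B \<inter> integer_points) = omega_count n"
proof -
  let ?S = "SIGMA t:{(u, v) \<in> faces. total_degree u + total_degree v \<le> n}.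
    {2 * int (total_degree (fst t)) - int n..int n - 2 * int (total_degree (snd t))}"
  let ?T = "(\<lambda>x. real n *\<^sub>R x) ` Omega_polytope hull_A hull_B \<inter> integer_points"
  let ?f = "\<lambda>(t, h). (real_vec (point t), real_of_int h)"
  have n': "real n > 0" using n by simp
  have image: "?f ` ?S = ?T"
  proof
    show "?f ` ?S \<subseteq> ?T"
    proof clarify
      fix u v h assume uv: "(u, v) \<in> faces" "total_degree u + total_degree v \<le> n"
        "h \<in> {2 * int (total_degree (fst (u, v))) - int n..int n - 2 * int (total_degree (snd (u, v)))}"
      \<comment> \<open>The bounds solve \<open>sum \<alpha> + sum \<beta> = n\<close> and
        \<open>sum \<alpha> - sum \<beta> = h\<close>. They may be half-integers, which does no harm
        as \<open>point_representation\<close> takes real sums.\<close>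
      then have "real (total_degree u) \<le> (real n + real_of_int h) / 2"
        "real (total_degree v) \<le> (real n - real_of_int h) / 2"
        by auto
      from point_representation[OF this] obtain \<alpha> \<beta> where
        ab: "\<forall>i. 0 \<le> \<alpha> i" "\<forall>j. 0 \<le> \<beta> j" "sum \<alpha> UNIV = (real n + real_of_int h) / 2"
        "sum \<beta> UNIV = (real n - real_of_int h) / 2"
        "\<forall>k. real_vec (point (u, v)) $ k = cone_map A \<alpha> k - cone_map B \<beta> k" by blast
      then have "(real_vec (point (u, v)), real_of_int h) \<in> (\<lambda>x. real n *\<^sub>R x) ` Omega_polytope hull_A hull_B"
        unfolding mem_scaled_Omega[OF n'] by (intro exI[of _ \<alpha>] exI[of _ \<beta>]) (simp add: field_simps)
      then show "(real_vec (point (u, v)), real_of_int h) \<in> ?T"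
        by (simp add: integer_points_vec integer_points_prod)
    qed
    show "?T \<subseteq> ?f ` ?S"
    proof
      fix y assume y: "y \<in> ?T"
      then obtain z h where z: "y = (real_vec z, real_of_int h)"
        by (auto simp: integer_points_prod integer_points_vec elim!: Ints_cases)
      from y obtain \<alpha> \<beta> where ab: "\<forall>i. 0 \<le> \<alpha> i" "\<forall>j. 0 \<le> \<beta> j" "sum \<alpha> UNIV + sum \<beta> UNIV = real n"
        "\<forall>k. real_vec z $ k = cone_map A \<alpha> k - cone_map B \<beta> k" "real_of_int h = sum \<alpha> UNIV - sum \<beta> UNIV"
        unfolding Int_iff z mem_scaled_Omega[OF n'] by blast
      then have "\<And>k. real_of_int (z $ k) = cone_map A \<alpha> k - cone_map B \<beta> k"
        by (simp add: real_vec_def)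
      then obtain u v where uv: "(u, v) \<in> faces" "point (u, v) = z"
        "real (total_degree u) \<le> sum \<alpha> UNIV" "real (total_degree v) \<le> sum \<beta> UNIV"
        using face_exists[of \<alpha> \<beta> z] ab(1,2) by blast
      have "2 * real (total_degree u) \<le> real n + real_of_int h" "2 * real (total_degree v) \<le> real n - real_of_int h"
        using uv(3,4) ab(3,5) by linarith+
      then have "2 * int (total_degree u) \<le> int n + h" "2 * int (total_degree v) \<le> int n - h"
        by linarith+
      then have "((u, v), h) \<in> ?S" using uv(1) by simp
      then show "y \<in> ?f ` ?S"
        using uv(2) by (intro image_eqI[of _ _ "((u, v), h)"]) (simp_all add: z)
    qed
  qed
  have inj: "inj_on ?f ?S"
  proof (rule inj_onI)
    fix s s' assume s: "s \<in> ?S" "s' \<in> ?S" "?f s = ?f s'"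
    obtain t h t' h' where st: "s = (t, h)" "s' = (t', h')" by (cases s, cases s')
    have "t = t'"
      using s unfolding st by (intro inj_onD[OF inj_on_point]) (auto dest: injD[OF inj_real_vec])
    then show "s = s'" using s(3) by (simp add: st)
  qed
  show ?thesis using card_image[OF inj] unfolding image omega_count_def .
qed

lemma delta_Gamma:
  "delta (Gamma_polytope hull_A hull_B) =
    (1 - fps_X) ^ (CARD('d) + 1) * Abs_fps (\<lambda>n. real (gamma_count n))"
proof -
  have "(\<lambda>n. if n = 0 then 1 else real (card ((\<lambda>x. real n *\<^sub>R x) ` Gamma_polytope hull_A hull_B \<inter> integer_points)))
      = (\<lambda>n. real (gamma_count n))"
    by (rule ext) (simp add: gamma_count_0 card_scaled_Gamma)
  then show ?thesis by (simp add: delta_def)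
qed

lemma delta_Omega:
  "delta (Omega_polytope hull_A hull_B) =
    (1 - fps_X) ^ (CARD('d) + 2) * Abs_fps (\<lambda>n. real (omega_count n))"
proof -
  have "(\<lambda>n. if n = 0 then 1 else real (card ((\<lambda>x. real n *\<^sub>R x) ` Omega_polytope hull_A hull_B \<inter> integer_points)))
      = (\<lambda>n. real (omega_count n))"
    by (rule ext) (simp add: omega_count_0 card_scaled_Omega)
  then show ?thesis by (simp add: delta_def)
qed

text \<open>The extra dimension brings one more factor \<open>1 - X\<close>, and
  \<open>omega_series\<close> trades it for \<open>1 + X\<close>.\<close>

lemma delta_Omega_eq:
  "delta (Omega_polytope hull_A hull_B) = (1 + fps_X) * delta (Gamma_polytope hull_A hull_B)"
proof -
  have "delta (Omega_polytope hull_A hull_B) =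
      (1 - fps_X) ^ (CARD('d) + 1) * ((1 - fps_X) * Abs_fps (\<lambda>n. real (omega_count n)))"
    unfolding delta_Omega by (simp add: algebra_simps)
  also have "\<dots> = (1 + fps_X) * delta (Gamma_polytope hull_A hull_B)"
    unfolding omega_series delta_Gamma by (simp only: mult.left_commute)
  finally show ?thesis .
qed

text \<open>By \<open>gamma_series\<close> the delta-series of Gamma is \<open>(1 - X)^d\<close>
  times a Hilbert series whose monomials have at most \<open>d\<close> variables each, hence a
  polynomial, and \<open>eval_one_doubling\<close> applies.\<close>

lemma normalized_volume_Omega_eq:
  "normalized_volume (Omega_polytope hull_A hull_B) = 2 * normalized_volume (Gamma_polytope hull_A hull_B)"
proof -
  have "delta (Gamma_polytope hull_A hull_B) =
      (1 - fps_X) ^ CARD('d) * ((1 - fps_X) * Abs_fps (\<lambda>n. real (gamma_count n)))"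
    unfolding delta_Gamma by (simp only: power_add power_one_right mult.assoc)
  then have "\<exists>q. delta (Gamma_polytope hull_A hull_B) = fps_of_poly q"
    using hilbert_series_joint_faces_polynomial unfolding gamma_series by simp
  then obtain q where "delta (Gamma_polytope hull_A hull_B) = fps_of_poly q" by (elim exE)
  then show ?thesis
    unfolding normalized_volume_def delta_Omega_eq by (rule eval_one_doubling)
qed

end

theorem theorem3p1:
  fixes A :: "int ^ 'n ^ 'd" and B :: "int ^ 'm ^ 'd"
    and p :: 'n and q :: 'm
    and lessA :: "'n rel" and lessB :: "'m rel"
    and P Q :: "(real ^ 'd) set"
  assumes "column p A = 0" and "column q B = 0"
    and "of_harmony A B"
    and "strict_linear_order_on UNIV lessA" and "strict_linear_order_on UNIV lessB"
    and "squarefree_ideal (initial_ideal lessA (toric_ideal A :: ('n, 'k::field) mpolynomial set))"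
    and "squarefree_ideal (initial_ideal lessB (toric_ideal B :: ('m, 'k) mpolynomial set))"
    and "\<And>i j. i \<noteq> j \<Longrightarrow> (\<And>k. A $ k $ i \<le> A $ k $ j) \<Longrightarrow> (i, j) \<in> lessA"
    and "\<And>i. i \<noteq> p \<Longrightarrow> (p, i) \<in> lessA"
    and "\<And>i. i \<noteq> q \<Longrightarrow> (q, i) \<in> lessB"
    and "lattice_polytope P" and "P \<inter> integer_points = real_vec ` columns A"
    and "lattice_polytope Q" and "Q \<inter> integer_points = real_vec ` columns B"
    and "(integer_points :: ((real ^ 'd) \<times> real) set)
           \<subseteq> integer_combinations ((Gamma_polytope P Q \<times> {1}) \<inter> integer_points)"
    and "(integer_points :: (((real ^ 'd) \<times> real) \<times> real) set)
           \<subseteq> integer_combinations ((Omega_polytope P Q \<times> {1}) \<inter> integer_points)"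
    and "Gamma_polytope P Q \<inter> integer_points =
           {real_vec (column i A) | i. i \<noteq> p} \<union> {- real_vec (column j B) | j. j \<noteq> q} \<union> {0}"
    and "Omega_polytope P Q \<inter> integer_points =
           {(real_vec (column i A), 1) | i. True} \<union> {(- real_vec (column j B), -1) | j. True} \<union> {0}"
  shows "delta (Omega_polytope P Q) = (1 + fps_X) * delta (Gamma_polytope P Q) \<and>
         normalized_volume (Omega_polytope P Q) = 2 * normalized_volume (Gamma_polytope P Q)"
proof -
  have FA: "standard_family A p (standard lessA A)"
    using assms(1,4,6,9) by (rule standard_family_standard)
  have FB: "standard_family B q (standard lessB B)"
    using assms(2,5,7,10) by (rule standard_family_standard)
  interpret FA: standard_family A p "standard lessA A" by (rule FA)
  interpret FB: standard_family B q "standard lessB B" by (rule FB)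
  have P: "P = convex hull (real_vec ` columns A)"
    using assms(11,12) by (rule lattice_polytope_eq_hull)
  have Q: "Q = convex hull (real_vec ` columns B)"
    using assms(13,14) by (rule lattice_polytope_eq_hull)
  \<comment> \<open>The listed integer points of Gamma are zero, columns of \<open>A\<close> and
    negated columns of \<open>B\<close>, so the lattice hypothesis on Gamma yields the spanning
    condition.\<close>
  have span: "\<exists>a\<in>FA.lattice. \<exists>b\<in>FB.lattice. z = a + b" for z
    using FA FB assms(15)
  proof (rule lattice_sum_spanning)
    show "Gamma_polytope P Q \<inter> integer_points \<subseteq>
        real_vec ` range (\<lambda>i. column i A) \<union> (\<lambda>z. - real_vec z) ` range (\<lambda>j. column j B) \<union> {0}"
      unfolding assms(17) by auto
  qed
  interpret harmony_pair A p "standard lessA A" B q "standard lessB B"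
    by unfold_locales (use assms(3) span in simp_all)
  have "P = hull_A" "Q = hull_B" by (simp_all only: P Q hull_A_def hull_B_def)
  then show ?thesis
    by (simp only: delta_Omega_eq normalized_volume_Omega_eq simp_thms)
qed

end
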